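(* For every $\delta\in(0,1)$ there is a constant $c_0(\delta)>0$, depending only on $\delta$, such that for every $c_e\ge c_0(\delta)$ the following holds. Let $\mathcal A:\mathbb R^{n_1\times n_2}\to\mathbb R^m$ be a linear map satisfying a $2r$-RIP with constant $\delta_{2r}\le\delta$. Let $X^*\in\mathbb R^{n_1\times n_2}$ have rank $r$, let $\sigma_r^*=\sigma_r(X^* )$ and $b=\mathcal A(X^* )$. Denote $\gamma=c_e/(2\sigma_r^* )$. Let $U_0\in\mathbb R^{n_1\times r}$, $V_0\in\mathbb R^{n_2\times r}$ be any matrices with $$\|U_0V_0^\top-X^*\|_F\le\frac{\sigma_r^*}{c_e},\qquad \|U_0^\top U_0-V_0^\top V_0\|_F\le\frac{\sigma_r^*}{2c_e}.$$ Let $(U_t,V_t)_{t\ge0}$ be the iterates of the updating variant of GNMR started at $(U_0,V_0)$ (defined in the context), and let $X_t=U_tV_t^\top$. Then $$\|X_{t+1}-X^*\|_F\le\gamma\,\|X_t-X^*\|_F^2\qquad\text{for all } t=0,1,2,\ldots$$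
   Context: $\sigma_i(X)$ is the $i$-th largest singular value of $X$; $\|\cdot\|_F$ is the Frobenius norm and $\|\cdot\|$ the Euclidean norm. RIP: a linear map $\mathcal A:\mathbb R^{n_1\times n_2}\to\mathbb R^m$ satisfies a $k$-RIP with constant $\delta_k\in[0,1)$ if $(1-\delta_k)\|X\|_F^2\le\|\mathcal A(X)\|^2\le(1+\delta_k)\|X\|_F^2$ for all $X\in\mathbb R^{n_1\times n_2}$ of rank at most $k$. Updating variant of GNMR (data $\mathcal A,b$): given $(U_t,V_t)\in\mathbb R^{n_1\times r}\times\mathbb R^{n_2\times r}$, let $(\Delta U_t,\Delta V_t)$ be the minimizer of $(\Delta U,\Delta V)\mapsto\|\mathcal A(U_tV_t^\top+U_t\Delta V^\top+\Delta U\,V_t^\top)-b\|^2$ over $\mathbb R^{n_1\times r}\times\mathbb R^{n_2\times r}$ with smallest value of $\|\Delta U\|_F^2+\|\Delta V\|_F^2$ (the minimal norm solution of this linear least squares problem, which is unique). Set $U_{t+1}=U_t+\Delta U_t$, $V_{t+1}=V_t+\Delta V_t$. *)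

theory Defs
  imports
    "Jordan_Normal_Form.Char_Poly"
    "Jordan_Normal_Form.DL_Rank"
    "HOL-Computational_Algebra.Polynomial"
begin

definition eucl_norm :: "real vec \<Rightarrow> real" where
  "eucl_norm v = sqrt (v \<bullet> v)"

definition frob_norm :: "real mat \<Rightarrow> real" where
  "frob_norm X = sqrt (\<Sum>i<dim_row X. \<Sum>j<dim_col X. (X $$ (i, j))\<^sup>2)"

abbreviation mat_rank :: "real mat \<Rightarrow> nat" where
  "mat_rank X \<equiv> vec_space.rank (dim_row X) X"

text \<open>
  The singular values of \<open>X\<close> are the square roots of the eigenvalues of \<open>X\<^sup>T X\<close>, counted with
  algebraic multiplicity and listed in decreasing order (the real symmetric matrix \<open>X\<^sup>T X\<close> has all
  its eigenvalues in \<open>\<real>\<close>). The list has length \<open>dim_col X\<close>, so for a wide matrix the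
  \<open>min (dim_row X) (dim_col X)\<close> singular values are followed by additional zeros.
\<close>

definition singular_values :: "real mat \<Rightarrow> real list" where
  "singular_values X =
     map sqrt (rev (sorted_list_of_multiset (proots (char_poly (transpose_mat X * X)))))"

text \<open>The index is one-based: \<open>singular_value 1 X\<close> is the largest singular value.\<close>

definition singular_value :: "nat \<Rightarrow> real mat \<Rightarrow> real" where
  "singular_value i X = singular_values X ! (i - 1)"

definition RIP :: "nat \<Rightarrow> nat \<Rightarrow> nat \<Rightarrow> real \<Rightarrow> (real mat \<Rightarrow> real vec) \<Rightarrow> bool" where
  "RIP n\<^sub>1 n\<^sub>2 k \<delta>\<^sub>k \<A> \<longleftrightarrow>
     0 \<le> \<delta>\<^sub>k \<and> \<delta>\<^sub>k < 1 \<and>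
     (\<forall>X\<in>carrier_mat n\<^sub>1 n\<^sub>2. mat_rank X \<le> k \<longrightarrow>
        (1 - \<delta>\<^sub>k) * (frob_norm X)\<^sup>2 \<le> (eucl_norm (\<A> X))\<^sup>2 \<and>
        (eucl_norm (\<A> X))\<^sup>2 \<le> (1 + \<delta>\<^sub>k) * (frob_norm X)\<^sup>2)"

definition gnmr_loss ::
  "(real mat \<Rightarrow> real vec) \<Rightarrow> real vec \<Rightarrow> real mat \<Rightarrow> real mat \<Rightarrow> real mat \<times> real mat \<Rightarrow> real" where
  "gnmr_loss \<A> b U V = (\<lambda>(\<Delta>U, \<Delta>V).
     (eucl_norm (\<A> (U * transpose_mat V + U * transpose_mat \<Delta>V + \<Delta>U * transpose_mat V) - b))\<^sup>2)"

definition gnmr_minimizer ::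
  "nat \<Rightarrow> nat \<Rightarrow> nat \<Rightarrow> (real mat \<Rightarrow> real vec) \<Rightarrow> real vec \<Rightarrow> real mat \<Rightarrow> real mat
    \<Rightarrow> real mat \<times> real mat \<Rightarrow> bool" where
  "gnmr_minimizer n\<^sub>1 n\<^sub>2 r \<A> b U V =
     is_arg_min (gnmr_loss \<A> b U V) (\<lambda>D. D \<in> carrier_mat n\<^sub>1 r \<times> carrier_mat n\<^sub>2 r)"

text \<open>
  The minimal norm solution of the least squares problem is unique, so the following predicate
  describes the update, and \<open>gnmr_iterates\<close> the sequence of iterates, as the graph of a function.
\<close>

definition gnmr_update ::
  "nat \<Rightarrow> nat \<Rightarrow> nat \<Rightarrow> (real mat \<Rightarrow> real vec) \<Rightarrow> real vec \<Rightarrow> real mat \<Rightarrow> real mat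
    \<Rightarrow> real mat \<times> real mat \<Rightarrow> bool" where
  "gnmr_update n\<^sub>1 n\<^sub>2 r \<A> b U V =
     is_arg_min (\<lambda>(\<Delta>U, \<Delta>V). (frob_norm \<Delta>U)\<^sup>2 + (frob_norm \<Delta>V)\<^sup>2) (gnmr_minimizer n\<^sub>1 n\<^sub>2 r \<A> b U V)"

definition gnmr_iterates ::
  "nat \<Rightarrow> nat \<Rightarrow> nat \<Rightarrow> (real mat \<Rightarrow> real vec) \<Rightarrow> real vec \<Rightarrow> real mat \<Rightarrow> real mat
    \<Rightarrow> (nat \<Rightarrow> real mat) \<Rightarrow> (nat \<Rightarrow> real mat) \<Rightarrow> bool" where
  "gnmr_iterates n\<^sub>1 n\<^sub>2 r \<A> b U\<^sub>0 V\<^sub>0 U V \<longleftrightarrow>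
     U 0 = U\<^sub>0 \<and> V 0 = V\<^sub>0 \<and>
     (\<forall>t. \<exists>\<Delta>U \<Delta>V. gnmr_update n\<^sub>1 n\<^sub>2 r \<A> b (U t) (V t) (\<Delta>U, \<Delta>V) \<and>
        U (Suc t) = U t + \<Delta>U \<and> V (Suc t) = V t + \<Delta>V)"

end

(*
  Write e = |U V^T - X|_F and let sigma be the r-th singular value of X. If (U, V) is nearly exact
  and nearly balanced, then multiplication by U and by V is bounded below by sqrt(sigma / 2), and X
  has an exact factorization (U + Z) (V + W)^T with |Z|, |W| = O(e / sqrt(sigma)); the second order
  term Z W^T is O(e^2 / sigma). The update linearizes around (U, V), so by the restricted isometry
  property its linear part agrees with that of (Z, W) up to a multiple of |Z W^T|. Minimality of the
  norm gives U^T dU = dV^T V, which makes the cross term in |U dV^T + dU V^T|^2 nonnegative and hence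
  bounds |dU|^2 + |dV|^2 by O(e^2 / sigma). Both remainders being quadratic, so is the new error. The
  same identity cancels the first order change of U^T U - V^T V, so that the imbalance grows by at
  most |dU|^2 + |dV|^2, and these increments are absorbed by the decrease of e.
*)
theory Submission
  imports Defs "HOL-Analysis.L2_Norm" "Jordan_Normal_Form.Schur_Decomposition"
begin

subsection \<open>The Frobenius inner product\<close>

definition finner :: "real mat \<Rightarrow> real mat \<Rightarrow> real" where
  "finner X Y = (\<Sum>i<dim_row X. \<Sum>j<dim_col X. X $$ (i, j) * Y $$ (i, j))"

lemma mult_mat_entry:
  fixes A B :: "real mat"
  assumes "i < dim_row A" "j < dim_col B" "dim_col A = dim_row B"
  shows "(A * B) $$ (i, j) = (\<Sum>k<dim_col A. A $$ (i, k) * B $$ (k, j))"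
  unfolding index_mult_mat(1)[OF assms(1,2)] scalar_prod_def
  by (rule sum.cong) (use assms in auto)

lemma mat_assoc:
  fixes A B C :: "real mat"
  assumes "dim_col A = dim_row B" "dim_col B = dim_row C"
  shows "A * B * C = A * (B * C)"
  by (rule assoc_mult_mat[of A "dim_row A" "dim_col A" B "dim_col B" C "dim_col C"]) (use assms in auto)

lemma mat_add_mult:
  fixes A B C :: "real mat"
  assumes "dim_row A = dim_row B" "dim_col A = dim_col B" "dim_col A = dim_row C"
  shows "(A + B) * C = A * C + B * C"
  by (rule add_mult_distrib_mat[of A "dim_row A" "dim_col A" B C "dim_col C"]) (use assms in auto)

lemma mat_mult_add:
  fixes A B C :: "real mat"
  assumes "dim_row B = dim_row C" "dim_col B = dim_col C" "dim_col A = dim_row C"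
  shows "A * (B + C) = A * B + A * C"
  by (rule mult_add_distrib_mat[of A "dim_row A" "dim_col A" B "dim_col B" C]) (use assms in auto)

lemma mat_minus_mult:
  fixes A B C :: "real mat"
  assumes "dim_row A = dim_row B" "dim_col A = dim_col B" "dim_col A = dim_row C"
  shows "(A - B) * C = A * C - B * C"
  by (rule minus_mult_distrib_mat[of A "dim_row A" "dim_col A" B C "dim_col C"]) (use assms in auto)

lemma mat_mult_minus:
  fixes A B C :: "real mat"
  assumes "dim_row B = dim_row C" "dim_col B = dim_col C" "dim_col A = dim_row C"
  shows "A * (B - C) = A * B - A * C"
  by (rule mult_minus_distrib_mat[of A "dim_row A" "dim_col A" B "dim_col B" C]) (use assms in auto)

lemma mat_smult_mult:
  fixes A B :: "real mat"
  assumes "dim_col A = dim_row B"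
  shows "(c \<cdot>\<^sub>m A) * B = c \<cdot>\<^sub>m (A * B)"
  by (rule mult_smult_assoc_mat[of A "dim_row A" "dim_col A" B "dim_col B"]) (use assms in auto)

lemma mat_mult_smult:
  fixes A B :: "real mat"
  assumes "dim_col A = dim_row B"
  shows "A * (c \<cdot>\<^sub>m B) = c \<cdot>\<^sub>m (A * B)"
  by (rule mult_smult_distrib[of A "dim_row A" "dim_col A" B "dim_col B"]) (use assms in auto)

lemma mat_transpose_mult:
  fixes A B :: "real mat"
  assumes "dim_col A = dim_row B"
  shows "transpose_mat (A * B) = transpose_mat B * transpose_mat A"
  by (rule transpose_mult[of A "dim_row A" "dim_col A" B "dim_col B"]) (use assms in auto)

lemma mat_transpose_add:
  fixes A B :: "real mat"
  assumes "dim_row A = dim_row B" "dim_col A = dim_col B"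
  shows "transpose_mat (A + B) = transpose_mat A + transpose_mat B"
  by (rule eq_matI) (use assms in auto)

lemma mat_transpose_minus:
  fixes A B :: "real mat"
  assumes "dim_row A = dim_row B" "dim_col A = dim_col B"
  shows "transpose_mat (A - B) = transpose_mat A - transpose_mat B"
  by (rule eq_matI) (use assms in auto)

lemma mat_transpose_smult:
  fixes A :: "real mat"
  shows "transpose_mat (c \<cdot>\<^sub>m A) = c \<cdot>\<^sub>m transpose_mat A"
  by (rule eq_matI) auto

lemma mat_one_mult: "dim_row A = n \<Longrightarrow> 1\<^sub>m n * A = (A :: real mat)"
  by auto

lemma mat_mult_one: "dim_col A = n \<Longrightarrow> A * 1\<^sub>m n = (A :: real mat)"
  by auto

lemmas mat_ring_simps = mat_assoc mat_add_mult mat_mult_add mat_minus_mult mat_mult_minus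
  mat_smult_mult mat_mult_smult mat_transpose_mult mat_transpose_add mat_transpose_minus
  mat_transpose_smult mat_one_mult mat_mult_one

lemma finner_commute:
  assumes "dim_row X = dim_row Y" "dim_col X = dim_col Y"
  shows "finner X Y = finner Y X"
  using assms by (simp add: finner_def mult.commute)

lemma finner_add_left:
  assumes "dim_row X = dim_row Z" "dim_col X = dim_col Z" "dim_row Y = dim_row Z" "dim_col Y = dim_col Z"
  shows "finner (X + Y) Z = finner X Z + finner Y Z"
  using assms by (simp add: finner_def distrib_right sum.distrib)

lemma finner_add_right:
  assumes "dim_row X = dim_row Z" "dim_col X = dim_col Z" "dim_row Y = dim_row Z" "dim_col Y = dim_col Z"
  shows "finner Z (X + Y) = finner Z X + finner Z Y"
  using assms by (simp add: finner_def distrib_left sum.distrib)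

lemma finner_minus_left:
  assumes "dim_row X = dim_row Z" "dim_col X = dim_col Z" "dim_row Y = dim_row Z" "dim_col Y = dim_col Z"
  shows "finner (X - Y) Z = finner X Z - finner Y Z"
  using assms by (simp add: finner_def left_diff_distrib sum_subtractf)

lemma finner_minus_right:
  assumes "dim_row X = dim_row Z" "dim_col X = dim_col Z" "dim_row Y = dim_row Z" "dim_col Y = dim_col Z"
  shows "finner Z (X - Y) = finner Z X - finner Z Y"
  using assms by (simp add: finner_def right_diff_distrib sum_subtractf)

lemma finner_smult_left:
  "finner (c \<cdot>\<^sub>m X) Z = c * finner X Z" 
  if "dim_row X = dim_row Z" "dim_col X = dim_col Z"
  using that by (simp add: finner_def mult.assoc sum_distrib_left)

lemma finner_smult_right:
  "finner Z (c \<cdot>\<^sub>m X) = c * finner Z X" 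
  if "dim_row X = dim_row Z" "dim_col X = dim_col Z"
  using that by (simp add: finner_def mult.left_commute sum_distrib_left)

lemmas finner_simps = finner_add_left finner_add_right finner_minus_left finner_minus_right
  finner_smult_left finner_smult_right

lemma finner_transpose:
  assumes "dim_row X = dim_row Y" "dim_col X = dim_col Y"
  shows "finner (transpose_mat X) (transpose_mat Y) = finner X Y"
  using assms unfolding finner_def by (subst sum.swap) simp

lemma finner_mult_left:
  assumes "dim_col A = dim_row B" "dim_row C = dim_row A" "dim_col C = dim_col B"
  shows "finner (A * B) C = finner B (transpose_mat A * C)"
proof -
  have "finner (A * B) C = (\<Sum>i<dim_row A. \<Sum>j<dim_col B. \<Sum>k<dim_row B. A $$ (i,k) * B $$ (k,j) * C $$ (i,j))"
    unfolding finner_def using assms by (intro sum.cong) (auto simp del: index_mult_mat(1) simp: mult_mat_entry sum_distrib_right)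
  also have "\<dots> = (\<Sum>j<dim_col B. \<Sum>i<dim_row A. \<Sum>k<dim_row B. A $$ (i,k) * B $$ (k,j) * C $$ (i,j))"
    by (rule sum.swap)
  also have "\<dots> = (\<Sum>j<dim_col B. \<Sum>k<dim_row B. \<Sum>i<dim_row A. A $$ (i,k) * B $$ (k,j) * C $$ (i,j))"
    by (intro sum.cong refl sum.swap)
  also have "\<dots> = (\<Sum>k<dim_row B. \<Sum>j<dim_col B. \<Sum>i<dim_row A. A $$ (i,k) * B $$ (k,j) * C $$ (i,j))"
    by (rule sum.swap)
  also have "\<dots> = finner B (transpose_mat A * C)"
    unfolding finner_def using assms
    by (intro sum.cong) (auto simp del: index_mult_mat(1) simp: mult_mat_entry sum_distrib_left intro!: sum.cong)
  finally show ?thesis .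
qed

lemma finner_mult_right:
  assumes "dim_col A = dim_row B" "dim_row C = dim_row A" "dim_col C = dim_col B"
  shows "finner (A * B) C = finner A (C * transpose_mat B)"
proof -
  have "finner (A * B) C = finner (transpose_mat B * transpose_mat A) (transpose_mat C)"
    using assms by (simp add: finner_transpose flip: mat_transpose_mult)
  also have "\<dots> = finner (transpose_mat A) (B * transpose_mat C)"
    using assms by (subst finner_mult_left) auto
  also have "\<dots> = finner (transpose_mat A) (transpose_mat (C * transpose_mat B))"
    using assms by (simp add: mat_transpose_mult)
  also have "\<dots> = finner A (C * transpose_mat B)"
    using assms by (simp add: finner_transpose)
  finally show ?thesis .
qed

lemma frob_norm_sq: "(frob_norm X)\<^sup>2 = finner X X"
  by (simp add: frob_norm_def finner_def sum_nonneg power2_eq_square)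

lemma frob_norm_nonneg [simp]: "0 \<le> frob_norm X"
  by (simp add: frob_norm_def sum_nonneg)

lemma frob_norm_L2_set:
  assumes "X \<in> carrier_mat n m"
  shows "frob_norm X = L2_set (\<lambda>p. X $$ p) ({..<n} \<times> {..<m})"
  using assms by (simp add: frob_norm_def L2_set_def sum.cartesian_product)

lemma frob_norm_triangle:
  assumes "dim_row X = dim_row Y" "dim_col X = dim_col Y"
  shows "frob_norm (X + Y) \<le> frob_norm X + frob_norm Y"
proof -
  have *: "X \<in> carrier_mat (dim_row Y) (dim_col Y)" "Y \<in> carrier_mat (dim_row Y) (dim_col Y)"
    "X + Y \<in> carrier_mat (dim_row Y) (dim_col Y)" using assms by auto
  have "L2_set (\<lambda>p. (X + Y) $$ p) ({..<dim_row Y} \<times> {..<dim_col Y})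
      = L2_set (\<lambda>p. X $$ p + Y $$ p) ({..<dim_row Y} \<times> {..<dim_col Y})"
    by (rule L2_set_cong) auto
  then show ?thesis
    unfolding *[THEN frob_norm_L2_set] using L2_set_triangle_ineq by simp
qed

lemma frob_norm_smult: "frob_norm (c \<cdot>\<^sub>m X) = \<bar>c\<bar> * frob_norm X"
proof -
  have "(frob_norm (c \<cdot>\<^sub>m X))\<^sup>2 = (\<bar>c\<bar> * frob_norm X)\<^sup>2"
    unfolding power_mult_distrib frob_norm_sq by (simp add: finner_simps power2_eq_square)
  then show ?thesis by (rule power2_eq_imp_eq) auto
qed

lemma frob_norm_transpose [simp]: "frob_norm (transpose_mat X) = frob_norm X"
  using finner_transpose[of X X] by (simp flip: frob_norm_sq)

lemma frob_norm_minus_commute: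
  assumes "dim_row X = dim_row Y" "dim_col X = dim_col Y"
  shows "frob_norm (X - Y) = frob_norm (Y - X)"
  using assms by (simp add: frob_norm_def power2_commute)

lemma frob_norm_triangle_minus:
  assumes "dim_row X = dim_row Y" "dim_col X = dim_col Y"
  shows "frob_norm (X - Y) \<le> frob_norm X + frob_norm Y"
proof -
  have "X - Y = X + (-1) \<cdot>\<^sub>m Y"
    by (rule eq_matI) (use assms in auto)
  then show ?thesis
    using frob_norm_triangle[of X "(-1) \<cdot>\<^sub>m Y"] assms by (simp add: frob_norm_smult)
qed

lemma finner_le_frob:
  assumes "dim_row X = dim_row Y" "dim_col X = dim_col Y"
  shows "\<bar>finner X Y\<bar> \<le> frob_norm X * frob_norm Y"
proof -
  have *: "X \<in> carrier_mat (dim_row Y) (dim_col Y)" "Y \<in> carrier_mat (dim_row Y) (dim_col Y)"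
    using assms by auto
  have "\<bar>finner X Y\<bar> = \<bar>\<Sum>p\<in>{..<dim_row Y} \<times> {..<dim_col Y}. X $$ p * Y $$ p\<bar>"
    unfolding finner_def using assms by (simp add: sum.cartesian_product case_prod_unfold)
  also have "\<dots> \<le> (\<Sum>p\<in>{..<dim_row Y} \<times> {..<dim_col Y}. \<bar>X $$ p\<bar> * \<bar>Y $$ p\<bar>)"
    by (rule order_trans[OF sum_abs]) (simp add: abs_mult)
  also have "\<dots> \<le> frob_norm X * frob_norm Y"
    unfolding *[THEN frob_norm_L2_set] by (rule L2_set_mult_ineq)
  finally show ?thesis .
qed

lemma frob_norm_mult_le:
  assumes "dim_col A = dim_row B"
  shows "frob_norm (A * B) \<le> frob_norm A * frob_norm B"
proof -
  have "(frob_norm (A * B))\<^sup>2 = (\<Sum>i<dim_row A. \<Sum>j<dim_col B. (\<Sum>k<dim_col A. A $$ (i, k) * B $$ (k, j))\<^sup>2)"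
    using assms by (auto simp del: index_mult_mat(1) simp: frob_norm_def sum_nonneg mult_mat_entry intro!: sum.cong)
  also have "\<dots> \<le> (\<Sum>i<dim_row A. \<Sum>j<dim_col B. (\<Sum>k<dim_col A. (A $$ (i, k))\<^sup>2) * (\<Sum>k<dim_col A. (B $$ (k, j))\<^sup>2))"
  proof (intro sum_mono)
    fix i j
    have "\<bar>\<Sum>k<dim_col A. A $$ (i, k) * B $$ (k, j)\<bar> \<le> (\<Sum>k<dim_col A. \<bar>A $$ (i, k)\<bar> * \<bar>B $$ (k, j)\<bar>)"
      by (rule order_trans[OF sum_abs]) (simp add: abs_mult)
    also have "\<dots> \<le> L2_set (\<lambda>k. A $$ (i, k)) {..<dim_col A} * L2_set (\<lambda>k. B $$ (k, j)) {..<dim_col A}"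
      by (rule L2_set_mult_ineq)
    finally have "\<bar>\<Sum>k<dim_col A. A $$ (i, k) * B $$ (k, j)\<bar>\<^sup>2
        \<le> (L2_set (\<lambda>k. A $$ (i, k)) {..<dim_col A} * L2_set (\<lambda>k. B $$ (k, j)) {..<dim_col A})\<^sup>2"
      by (rule power_mono) simp
    then show "(\<Sum>k<dim_col A. A $$ (i, k) * B $$ (k, j))\<^sup>2
        \<le> (\<Sum>k<dim_col A. (A $$ (i, k))\<^sup>2) * (\<Sum>k<dim_col A. (B $$ (k, j))\<^sup>2)"
      by (simp add: L2_set_def power_mult_distrib sum_nonneg)
  qed
  also have "\<dots> = (\<Sum>i<dim_row A. \<Sum>k<dim_col A. (A $$ (i, k))\<^sup>2) * (\<Sum>j<dim_col B. \<Sum>k<dim_col A. (B $$ (k, j))\<^sup>2)"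
    by (rule sum_product[symmetric])
  also have "(\<Sum>j<dim_col B. \<Sum>k<dim_col A. (B $$ (k, j))\<^sup>2) = (frob_norm B)\<^sup>2"
    using assms by (subst sum.swap) (simp add: frob_norm_def sum_nonneg)
  also have "(\<Sum>i<dim_row A. \<Sum>k<dim_col A. (A $$ (i, k))\<^sup>2) = (frob_norm A)\<^sup>2"
    by (simp add: frob_norm_def sum_nonneg)
  finally have "(frob_norm (A * B))\<^sup>2 \<le> (frob_norm A * frob_norm B)\<^sup>2"
    by (simp only: power_mult_distrib)
  then show ?thesis
    by (rule power2_le_imp_le) simp
qed

lemma finner_self_eq_0D:
  assumes "finner X X = 0"
  shows "X = 0\<^sub>m (dim_row X) (dim_col X)"
proof (rule eq_matI)
  fix i j assume ij: "i < dim_row (0\<^sub>m (dim_row X) (dim_col X))" "j < dim_col (0\<^sub>m (dim_row X) (dim_col X))"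
  have "(\<Sum>i<dim_row X. \<Sum>j<dim_col X. X $$ (i, j) * X $$ (i, j)) = 0"
    using assms by (simp add: finner_def)
  then have "\<forall>i<dim_row X. (\<Sum>j<dim_col X. X $$ (i, j) * X $$ (i, j)) = 0"
    by (subst (asm) sum_nonneg_eq_0_iff) (auto intro: sum_nonneg)
  then have "(\<Sum>j<dim_col X. X $$ (i, j) * X $$ (i, j)) = 0"
    using ij by simp
  then have "\<forall>j<dim_col X. X $$ (i, j) * X $$ (i, j) = 0"
    by (subst (asm) sum_nonneg_eq_0_iff) auto
  then show "X $$ (i, j) = 0\<^sub>m (dim_row X) (dim_col X) $$ (i, j)"
    using ij by auto
qed auto

lemma frob_norm_isometry:
  assumes "transpose_mat B * B = 1\<^sub>m (dim_col B)" "dim_col B = dim_row Y"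
  shows "frob_norm (B * Y) = frob_norm Y"
proof -
  have "finner (B * Y) (B * Y) = finner Y ((transpose_mat B * B) * Y)"
    using assms(2) by (subst finner_mult_left) (auto simp: mat_assoc)
  then have "(frob_norm (B * Y))\<^sup>2 = (frob_norm Y)\<^sup>2"
    using assms by (simp add: frob_norm_sq)
  then show ?thesis by (rule power2_eq_imp_eq) auto
qed

lemma frob_norm_coisometry_le:
  assumes "transpose_mat B * B = 1\<^sub>m (dim_col B)" "dim_row B = dim_row Y"
  shows "frob_norm (transpose_mat B * Y) \<le> frob_norm Y"
proof -
  let ?W = "transpose_mat B * Y"
  have "(frob_norm ?W)\<^sup>2 = finner Y (B * ?W)"
    unfolding frob_norm_sq using assms(2) by (subst finner_mult_left) auto
  also have "\<dots> \<le> frob_norm Y * frob_norm (B * ?W)"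
    using assms(2) finner_le_frob[of Y "B * ?W"] by simp
  also have "frob_norm (B * ?W) = frob_norm ?W"
    using assms by (intro frob_norm_isometry) auto
  finally have "frob_norm ?W * frob_norm ?W \<le> frob_norm Y * frob_norm ?W"
    by (simp add: power2_eq_square)
  then show ?thesis
    by (cases "frob_norm ?W = 0") (auto simp: mult_le_cancel_right less_le)
qed

subsection \<open>Rank of products\<close>

lemma rank_mult_le_inner:
  fixes A B :: "real mat"
  assumes "A \<in> carrier_mat n k" "B \<in> carrier_mat k m"
  shows "vec_space.rank n (A * B) \<le> k"
proof -
  interpret vec_space "TYPE(real)" n .
  define S where "S l = mat n m (\<lambda>(i, j). \<Sum>q<l. A $$ (i, q) * B $$ (q, j))" for l
  have "rank (S l) \<le> l" for l
  proof (induction l)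
    case 0
    have "S 0 = 0\<^sub>m n m" unfolding S_def by (rule eq_matI) auto
    then show ?case by (simp add: rank_0I)
  next
    case (Suc l)
    define P where "P = mat n m (\<lambda>(i, j). A $$ (i, l) * B $$ (l, j))"
    have "S (Suc l) = S l + P" unfolding S_def P_def by (rule eq_matI) auto
    moreover have "rank P \<le> 1"
      by (rule rank_le_1_product_entries[of P m "\<lambda>i. A $$ (i, l)" "\<lambda>j. B $$ (l, j)"]) (auto simp: P_def)
    moreover have "rank (S l + P) \<le> rank (S l) + rank P"
      by (rule rank_subadditive[of _ m]) (auto simp: S_def P_def)
    ultimately show ?case using Suc by simp
  qed
  moreover have "S k = A * B"
    unfolding S_def by (rule eq_matI) (use assms in \<open>auto simp del: index_mult_mat(1) simp: mult_mat_entry\<close>)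
  ultimately show ?thesis by metis
qed

lemma rank_mult_le_left:
  fixes A B :: "real mat"
  assumes A: "A \<in> carrier_mat n k" and B: "B \<in> carrier_mat k m"
  shows "vec_space.rank n (A * B) \<le> vec_space.rank n A"
proof -
  interpret vec_space "TYPE(real)" n .
  have cA: "set (cols A) \<subseteq> carrier_vec n" using A cols_dim by blast
  have "set (cols (A * B)) \<subseteq> span (set (cols A))"
  proof
    fix x assume "x \<in> set (cols (A * B))"
    then obtain j where "j < dim_col (A * B)" "x = col (A * B) j"
      by (metis cols_length cols_nth in_set_conv_nth)
    then have "x = A *\<^sub>v col B j" using A B by (auto intro!: eq_vecI)
    moreover have "A *\<^sub>v col B j \<in> span (set (cols A))"
      using A B \<open>j < dim_col (A * B)\<close> col_space_eq[OF A] unfolding col_space_def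
      by auto
    ultimately show "x \<in> span (set (cols A))" by simp
  qed
  then have sub: "span (set (cols (A * B))) \<subseteq> span (set (cols A))"
    by (intro span_is_subset span_is_submodule cA)
  have "set (cols (A * B)) \<subseteq> carrier_vec n"
    using A B cols_dim[of "A * B"] by auto
  then have "subspace class_ring (span (set (cols (A * B)))) (span_vs (set (cols A)))"
    by (intro nested_subspaces span_is_subspace cA sub)
  moreover have "vectorspace.fin_dim class_ring (span_vs (set (cols A)))"
    using A by (rule fin_dim_span_cols)
  moreover have "vectorspace class_ring (span_vs (set (cols A)))"
    using span_is_subspace[OF cA] by (rule subspace_is_vs)
  ultimately show ?thesis
    unfolding rank_def using vectorspace.subspace_dim fin_dim_span_cols[of "A * B" m] A B by fastforce
qed

subsection \<open>Spectral theorem for real symmetric matrices\<close>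

lemma real_symmetric_eigenvalue_real:
  fixes A :: "real mat" and a :: complex
  assumes A: "A \<in> carrier_mat n n" and sym: "transpose_mat A = A"
    and ev: "eigenvalue (map_mat of_real A) a"
  shows "a \<in> \<real>"
proof -
  let ?C = "map_mat complex_of_real A"
  obtain v where v: "v \<in> carrier_vec n" "v \<noteq> 0\<^sub>v n" "?C *\<^sub>v v = a \<cdot>\<^sub>v v"
    using ev A unfolding eigenvalue_def eigenvector_def by auto
  have A_sym: "A $$ (j, i) = A $$ (i, j)" if "i < n" "j < n" for i j
    using arg_cong[OF sym, of "\<lambda>M. M $$ (i, j)"] A that by simp
  have row: "(\<Sum>j<n. of_real (A $$ (i, j)) * v $ j) = a * v $ i" if "i < n" for i
  proof -
    have "(?C *\<^sub>v v) $ i = (a \<cdot>\<^sub>v v) $ i" using v(3) by simp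
    moreover have "(?C *\<^sub>v v) $ i = (\<Sum>j<n. of_real (A $$ (i, j)) * v $ j)"
      using A v(1) that by (auto simp: scalar_prod_def atLeast0LessThan intro!: sum.cong)
    ultimately show ?thesis using v(1) that by simp
  qed
  define z where "z = (\<Sum>i<n. \<Sum>j<n. cnj (v $ i) * of_real (A $$ (i, j)) * v $ j)"
  define N where "N = (\<Sum>i<n. (cmod (v $ i))\<^sup>2)"
  have zN: "z = a * of_real N"
  proof -
    have "z = (\<Sum>i<n. cnj (v $ i) * (a * v $ i))"
      unfolding z_def by (intro sum.cong refl) (simp add: sum_distrib_left mult.assoc flip: row)
    also have "\<dots> = (\<Sum>i<n. a * of_real ((cmod (v $ i))\<^sup>2))"
      by (intro sum.cong refl) (simp only: complex_norm_square mult_ac)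
    finally show ?thesis by (simp add: N_def sum_distrib_left)
  qed
  have "cnj z = (\<Sum>i<n. \<Sum>j<n. cnj (v $ j) * of_real (A $$ (i, j)) * v $ i)"
    unfolding z_def cnj_sum by (intro sum.cong refl) (simp add: mult_ac)
  also have "\<dots> = (\<Sum>j<n. \<Sum>i<n. cnj (v $ j) * of_real (A $$ (i, j)) * v $ i)"
    by (rule sum.swap)
  also have "\<dots> = z"
    unfolding z_def by (intro sum.cong refl) (simp add: A_sym)
  finally have "cnj z = z" .
  then have "cnj a * of_real N = a * of_real N"
    by (simp add: zN)
  moreover have "N \<noteq> 0"
  proof
    assume "N = 0"
    then have "\<forall>i<n. v $ i = 0"
      unfolding N_def by (subst (asm) sum_nonneg_eq_0_iff) auto
    then have "v = 0\<^sub>v n" using v(1) by (intro eq_vecI) auto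
    with v(2) show False by simp
  qed
  ultimately have "cnj a = a" by simp
  then show ?thesis by (simp add: Reals_cnj_iff)
qed

lemma real_symmetric_char_poly_splits:
  fixes A :: "real mat"
  assumes A: "A \<in> carrier_mat n n" and sym: "transpose_mat A = A"
  shows "\<exists>es. char_poly A = (\<Prod>e\<leftarrow>es. [:- e, 1:])"
proof -
  interpret cp: map_poly_inj_idom_hom complex_of_real ..
  let ?C = "map_mat complex_of_real A"
  have C: "?C \<in> carrier_mat n n" using A by simp
  obtain as where as: "char_poly ?C = (\<Prod>a\<leftarrow>as. [:- a, 1:])"
    using char_poly_factorized[OF C] by blast
  have "a \<in> \<real>" if "a \<in> set as" for a
  proof (rule real_symmetric_eigenvalue_real[OF A sym])
    have "poly (char_poly ?C) a = 0"
      unfolding as using that by (auto simp: poly_prod_list prod_list_zero_iff)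
    then show "eigenvalue ?C a" using eigenvalue_root_char_poly[OF C] by simp
  qed
  then have re: "map (\<lambda>a. of_real (Re a)) as = as"
    by (intro map_idI) simp
  have "map_poly complex_of_real (char_poly A) = char_poly ?C"
    by (rule of_real_hom.char_poly_hom[OF A, symmetric])
  also have "\<dots> = (\<Prod>a\<leftarrow>map (\<lambda>a. of_real (Re a)) as. [:- a, 1:])"
    unfolding re as ..
  also have "\<dots> = map_poly complex_of_real (\<Prod>a\<leftarrow>map Re as. [:- a, 1:])"
    by (induction as) (simp_all add: cp.hom_mult del: mult_pCons_left)
  finally have "char_poly A = (\<Prod>a\<leftarrow>map Re as. [:- a, 1:])"
    by (rule cp.injectivity)
  then show ?thesis by blast
qed

lemma orthonormal_completion:
  fixes v :: "real vec"
  assumes v: "v \<in> carrier_vec n" "v \<noteq> 0\<^sub>v n"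
  shows "\<exists>W c. W \<in> carrier_mat n n \<and> transpose_mat W * W = 1\<^sub>m n \<and> col W 0 = c \<cdot>\<^sub>v v"
proof -
  interpret cof_vec_space n "TYPE(real)" .
  define b where "b = basis_completion v"
  define ws where "ws = gram_schmidt n b"
  from basis_completion[OF v, folded b_def]
  have dist_b: "distinct b" and indep: "\<not> lin_dep (set b)" and b: "set b \<subseteq> carrier_vec n"
    and hdb: "hd b = v" and len_b: "length b = n" by auto
  have n: "n \<noteq> 0" using v by (metis carrier_vecD eq_vecI index_zero_vec(2) not_less_zero)
  from hdb len_b n obtain vs where bv: "b = v # vs" by (cases b, auto)
  from gram_schmidt_result[OF b dist_b indep refl, folded ws_def]
  have ws: "set ws \<subseteq> carrier_vec n" "corthogonal ws" "length ws = n"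
    by (auto simp: len_b)
  from gram_schmidt_hd[OF v(1), of vs, folded bv] have hdws: "hd ws = v" unfolding ws_def .
  define nw where "nw w = sqrt (w \<bullet> w)" for w :: "real vec"
  define W where "W = mat_of_cols n (map (\<lambda>w. (1 / nw w) \<cdot>\<^sub>v w) ws)"
  have wsi: "ws ! i \<in> carrier_vec n" if "i < n" for i using ws that by auto
  have orth: "ws ! i \<bullet> ws ! j = 0 \<longleftrightarrow> i \<noteq> j" if "i < n" "j < n" for i j
    using corthogonalD[OF ws(2), of i j] that ws(3) by simp
  have nw_sq: "nw (ws ! i) * nw (ws ! i) = ws ! i \<bullet> ws ! i" for i
    by (simp add: nw_def scalar_prod_def sum_nonneg)
  have nw_nz: "nw (ws ! i) \<noteq> 0" if "i < n" for i
    using orth[OF that that] nw_sq[of i] by auto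
  have colW: "col W i = (1 / nw (ws ! i)) \<cdot>\<^sub>v ws ! i" if "i < n" for i
    unfolding W_def using that ws(3) wsi[OF that] by (subst col_mat_of_cols) auto
  have W: "W \<in> carrier_mat n n" unfolding W_def using ws(3) by auto
  have "transpose_mat W * W = 1\<^sub>m n"
  proof (rule eq_matI)
    fix i j assume "i < dim_row (1\<^sub>m n :: real mat)" "j < dim_col (1\<^sub>m n :: real mat)"
    then have ij: "i < n" "j < n" by auto
    have "(transpose_mat W * W) $$ (i, j) = col W i \<bullet> col W j"
      using W ij by simp
    also have "\<dots> = (1 / nw (ws ! i)) * (1 / nw (ws ! j)) * (ws ! i \<bullet> ws ! j)"
      using ij wsi[OF ij(1)] wsi[OF ij(2)] by (simp add: colW)
    also have "\<dots> = 1\<^sub>m n $$ (i, j)"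
      using orth[OF ij] nw_nz[OF ij(1)] nw_sq[of i] ij by (cases "i = j") (auto simp: field_simps)
    finally show "(transpose_mat W * W) $$ (i, j) = 1\<^sub>m n $$ (i, j)" .
  qed (use W in auto)
  moreover have "col W 0 = (1 / nw (ws ! 0)) \<cdot>\<^sub>v v"
    using colW[of 0] n hdws ws(3) by (cases ws) auto
  ultimately show ?thesis using W by blast
qed

lemma real_symmetric_diagonalization:
  fixes A :: "real mat"
  assumes "A \<in> carrier_mat n n" "transpose_mat A = A" "char_poly A = (\<Prod>e\<leftarrow>es. [:- e, 1:])"
  shows "\<exists>P. P \<in> carrier_mat n n \<and> transpose_mat P * P = 1\<^sub>m n \<and>
    transpose_mat P * A * P = mat_diag n (\<lambda>i. es ! i)"
  using assms
proof (induction es arbitrary: n A)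
  case Nil
  then have "n = 0" using degree_monic_char_poly[of A n] by auto
  then show ?case using Nil by (intro exI[of _ "1\<^sub>m n"]) (auto simp: mat_diag_def)
next
  case (Cons e es n A)
  note A = Cons.prems(1) and sym = Cons.prems(2)
  have cp: "char_poly A = [:- e, 1:] * (\<Prod>e\<leftarrow>es. [:- e, 1:])" using Cons.prems(3) by simp
  have "poly (char_poly A) e = 0" unfolding cp by simp
  then obtain v where v: "v \<in> carrier_vec n" "v \<noteq> 0\<^sub>v n" "A *\<^sub>v v = e \<cdot>\<^sub>v v"
    using A unfolding eigenvalue_root_char_poly[OF A, symmetric] eigenvalue_def eigenvector_def by auto
  have "n \<noteq> 0" using v by (metis carrier_vecD eq_vecI index_zero_vec(2) not_less_zero)
  then obtain k where n: "n = Suc k" by (cases n) auto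
  obtain W c where W: "W \<in> carrier_mat n n" and WW: "transpose_mat W * W = 1\<^sub>m n"
    and W0: "col W 0 = c \<cdot>\<^sub>v v"
    using orthonormal_completion[OF v(1,2)] by blast
  have WW': "W * transpose_mat W = 1\<^sub>m n"
    using mat_mult_left_right_inverse[of "transpose_mat W" n W] W WW by simp
  define A' where "A' = transpose_mat W * A * W"
  have A': "A' \<in> carrier_mat n n" unfolding A'_def using A W by auto
  have symA': "transpose_mat A' = A'"
    unfolding A'_def using A W sym by (simp add: mat_transpose_mult mat_assoc)
  have col0: "A' $$ (i, 0) = (if i = 0 then e else 0)" if i: "i < n" for i
  proof -
    have cW: "col W 0 \<in> carrier_vec n"
      using W by (metis col_dim carrier_matD(1))
    have "A' = transpose_mat W * (A * W)"
      unfolding A'_def using A W by (simp add: mat_assoc)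
    then have "col A' 0 = col (transpose_mat W * (A * W)) 0" by (rule arg_cong)
    also have "\<dots> = transpose_mat W *\<^sub>v col (A * W) 0"
      by (rule col_mult2[of _ n n _ n]) (use A W n in auto)
    also have "col (A * W) 0 = A *\<^sub>v col W 0"
      by (rule col_mult2[OF A W]) (use n in simp)
    also have "A *\<^sub>v col W 0 = e \<cdot>\<^sub>v col W 0"
      unfolding W0 using v A by (simp add: mult_mat_vec[of _ n n] smult_smult_assoc mult.commute)
    also have "transpose_mat W *\<^sub>v (e \<cdot>\<^sub>v col W 0) = e \<cdot>\<^sub>v (transpose_mat W *\<^sub>v col W 0)"
      by (rule mult_mat_vec[of _ n n]) (use W cW in simp_all)
    also have "transpose_mat W *\<^sub>v col W 0 = col (transpose_mat W * W) 0"
      by (rule col_mult2[symmetric, of _ n n _ n]) (use W n in simp_all)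
    finally have "col A' 0 $ i = (e \<cdot>\<^sub>v col (1\<^sub>m n) 0) $ i" by (simp only: WW)
    then show ?thesis using A' n i by simp
  qed
  have row0: "A' $$ (0, i) = (if i = 0 then e else 0)" if i: "i < n" for i
    using arg_cong[OF symA', of "\<lambda>M. M $$ (0, i)"] col0[OF i] A' n i by simp
  define D where "D = mat k k (\<lambda>(i, j). A' $$ (Suc i, Suc j))"
  define E where "E = mat 1 1 (\<lambda>_. e)"
  have D: "D \<in> carrier_mat k k" and E: "E \<in> carrier_mat 1 1" unfolding D_def E_def by auto
  have blk: "A' = four_block_mat E (0\<^sub>m 1 k) (0\<^sub>m k 1) D"
    by (rule eq_matI) (use A' n in \<open>auto simp: D_def E_def col0 row0\<close>)
  have symD: "transpose_mat D = D"
  proof (rule eq_matI)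
    fix i j assume "i < dim_row D" "j < dim_col D"
    then have "i < k" "j < k" unfolding D_def by auto
    then show "transpose_mat D $$ (i, j) = D $$ (i, j)"
      using arg_cong[OF symA', of "\<lambda>M. M $$ (Suc i, Suc j)"] A' n by (simp add: D_def)
  qed (auto simp: D_def)
  have "similar_mat A' A"
    unfolding similar_mat_def similar_mat_wit_def
    by (intro exI[of _ "transpose_mat W"] exI[of _ W]) (use A A' W WW WW' in \<open>auto simp: A'_def\<close>)
  then have "char_poly A = char_poly A'" by (simp add: char_poly_similar)
  also have "\<dots> = char_poly E * char_poly D"
    unfolding blk by (rule char_poly_four_block_zeros_col[OF E _ D]) auto
  also have "char_poly E = [:- e, 1:]"
    by (simp add: E_def char_poly_defs det_def sign_def)
  finally have "char_poly D = (\<Prod>e\<leftarrow>es. [:- e, 1:])"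
    unfolding cp by (metis mult_cancel_left pCons_eq_0_iff zero_neq_one)
  from Cons.IH[OF D symD this] obtain Q where Q: "Q \<in> carrier_mat k k"
    "transpose_mat Q * Q = 1\<^sub>m k" "transpose_mat Q * D * Q = mat_diag k (\<lambda>i. es ! i)"
    by blast
  define F where "F = four_block_mat (1\<^sub>m 1) (0\<^sub>m 1 k) (0\<^sub>m k 1) Q"
  have F: "F \<in> carrier_mat n n" unfolding F_def using Q n by auto
  have FT: "transpose_mat F = four_block_mat (1\<^sub>m 1) (0\<^sub>m 1 k) (0\<^sub>m k 1) (transpose_mat Q)"
    unfolding F_def using Q(1) by (subst transpose_four_block_mat[of _ 1 1 _ k _ k]) auto
  have FF: "transpose_mat F * F = 1\<^sub>m n"
    unfolding FT unfolding F_def using Q(1,2) n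
    by (subst mult_four_block_mat[of _ 1 1 _ k _ k _ _ 1 _ k]) (auto intro!: eq_matI)
  have "transpose_mat F * A' = four_block_mat E (0\<^sub>m 1 k) (0\<^sub>m k 1) (transpose_mat Q * D)"
    unfolding FT blk using Q(1) E D
    by (subst mult_four_block_mat[of _ 1 1 _ k _ k _ _ 1 _ k]) auto
  then have "transpose_mat F * A' * F = four_block_mat E (0\<^sub>m 1 k) (0\<^sub>m k 1) (mat_diag k (\<lambda>i. es ! i))"
    unfolding F_def using Q E D
    by (simp only:) (subst mult_four_block_mat[of _ 1 1 _ k _ k _ _ 1 _ k], auto)
  also have "\<dots> = mat_diag n (\<lambda>i. (e # es) ! i)"
    by (rule eq_matI) (use n in \<open>auto simp: E_def mat_diag_def nth_Cons' \<close>)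
  finally have diag: "transpose_mat F * A' * F = mat_diag n (\<lambda>i. (e # es) ! i)" .
  show ?case
  proof (intro exI[of _ "W * F"] conjI)
    show "W * F \<in> carrier_mat n n" using W F by auto
    have "transpose_mat (W * F) * (W * F) = transpose_mat F * (transpose_mat W * W) * F"
      using W F by (simp add: mat_transpose_mult mat_assoc)
    then show "transpose_mat (W * F) * (W * F) = 1\<^sub>m n" using F FF by (simp add: WW)
    have "transpose_mat (W * F) * A * (W * F) = transpose_mat F * A' * F"
      unfolding A'_def using W F A by (simp add: mat_transpose_mult mat_assoc)
    then show "transpose_mat (W * F) * A * (W * F) = mat_diag n (\<lambda>i. (e # es) ! i)"
      using diag by simp
  qed
qed

subsection \<open>Compact singular value decomposition\<close>

definition first_cols :: "nat \<Rightarrow> real mat \<Rightarrow> real mat" where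
  "first_cols k P = mat (dim_row P) k (\<lambda>(i, j). P $$ (i, j))"

lemma dim_first_cols [simp]:
  "dim_row (first_cols k P) = dim_row P" "dim_col (first_cols k P) = k"
  by (simp_all add: first_cols_def)

lemma mult_first_cols:
  assumes "k \<le> dim_col P" "dim_col A = dim_row P"
  shows "A * first_cols k P = first_cols k (A * P)"
  by (rule eq_matI)
    (use assms in \<open>auto simp del: index_mult_mat(1) simp: first_cols_def mult_mat_entry\<close>)

lemma gram_first_cols:
  assumes "k \<le> dim_col P" "i < k" "j < k"
  shows "(transpose_mat (first_cols k P) * first_cols k P) $$ (i, j) = (transpose_mat P * P) $$ (i, j)"
  using assms by (subst (1 2) mult_mat_entry) (auto simp: first_cols_def)

text \<open>If the columns of \<open>Z = X P\<close> from the \<open>k\<close>-th on vanish, then \<open>X = Z P\<^sup>T\<close> only involves the first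
  \<open>k\<close> columns.\<close>

lemma truncated_decomposition:
  assumes X: "X \<in> carrier_mat n1 n2" and P: "P \<in> carrier_mat n2 n2"
    and PP: "transpose_mat P * P = 1\<^sub>m n2" and k: "k \<le> n2"
    and gram: "transpose_mat (X * P) * (X * P) = mat_diag n2 f"
    and zero: "\<And>j. k \<le> j \<Longrightarrow> j < n2 \<Longrightarrow> f j = 0"
  shows "X = X * first_cols k P * transpose_mat (first_cols k P)"
proof -
  let ?Z = "X * P"
  have Z0: "?Z $$ (i, j) = 0" if "i < n1" "k \<le> j" "j < n2" for i j
  proof -
    have "(transpose_mat ?Z * ?Z) $$ (j, j) = 0"
      using that zero unfolding gram by (simp add: mat_diag_def)
    moreover have "(transpose_mat ?Z * ?Z) $$ (j, j) = (\<Sum>i<n1. ?Z $$ (i, j) * ?Z $$ (i, j))"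
      using X P that by (subst mult_mat_entry) auto
    ultimately have "(\<Sum>i<n1. ?Z $$ (i, j) * ?Z $$ (i, j)) = 0"
      by (simp only:)
    then have "\<forall>i\<in>{..<n1}. ?Z $$ (i, j) * ?Z $$ (i, j) = 0"
      by (subst (asm) sum_nonneg_eq_0_iff) simp_all
    then show ?thesis using that by simp
  qed
  have "P * transpose_mat P = 1\<^sub>m n2"
    using mat_mult_left_right_inverse[of "transpose_mat P" n2 P] P PP by simp
  then have "X = ?Z * transpose_mat P"
    using X P by (simp add: mat_assoc)
  also have "\<dots> = first_cols k ?Z * transpose_mat (first_cols k P)"
  proof (rule eq_matI)
    fix i j assume "i < dim_row (first_cols k ?Z * transpose_mat (first_cols k P))"
      "j < dim_col (first_cols k ?Z * transpose_mat (first_cols k P))"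
    then have ij: "i < n1" "j < n2" using X P by auto
    have "(?Z * transpose_mat P) $$ (i, j) = (\<Sum>l<n2. ?Z $$ (i, l) * P $$ (j, l))"
      using X P ij by (subst mult_mat_entry) (auto simp del: index_mult_mat(1))
    also have "\<dots> = (\<Sum>l<k. ?Z $$ (i, l) * P $$ (j, l))"
      by (rule sum.mono_neutral_right) (use k ij Z0 in auto)
    also have "\<dots> = (first_cols k ?Z * transpose_mat (first_cols k P)) $$ (i, j)"
      using X P ij k by (subst mult_mat_entry) (auto simp del: index_mult_mat(1) simp: first_cols_def)
    finally show "(?Z * transpose_mat P) $$ (i, j) = (first_cols k ?Z * transpose_mat (first_cols k P)) $$ (i, j)" .
  qed (use X P in auto)
  finally show ?thesis
    using X P k by (simp add: mult_first_cols)
qed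

lemma rank_eq_if_gram_positive_diag:
  fixes A :: "real mat"
  assumes A: "A \<in> carrier_mat n k" and gram: "transpose_mat A * A = mat_diag k f"
    and pos: "\<And>j. j < k \<Longrightarrow> f j > 0"
  shows "vec_space.rank n A = k"
proof -
  interpret vec_space "TYPE(real)" n .
  have inj: "v = 0\<^sub>v k" if v: "v \<in> carrier_vec k" "A *\<^sub>v v = 0\<^sub>v n" for v
  proof (rule eq_vecI)
    fix j assume "j < dim_vec (0\<^sub>v k :: real vec)"
    then have j: "j < k" by simp
    have "transpose_mat A *\<^sub>v (A *\<^sub>v v) = (transpose_mat A * A) *\<^sub>v v"
      using A v by (intro assoc_mult_mat_vec[symmetric]) auto
    then have "(mat_diag k f *\<^sub>v v) $ j = (transpose_mat A *\<^sub>v 0\<^sub>v n) $ j"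
      by (simp add: gram v(2))
    also have "\<dots> = 0" using A j by simp
    also have "(mat_diag k f *\<^sub>v v) $ j = (\<Sum>i<k. (if j = i then f i else 0) * v $ i)"
      using v j by (auto simp: mat_diag_def scalar_prod_def atLeast0LessThan intro!: sum.cong)
    also have "\<dots> = f j * v $ j"
      using j by (simp add: if_distrib[of "\<lambda>x. x * _"] sum.delta cong: if_cong)
    finally show "v $ j = 0\<^sub>v k $ j" using pos[OF j] j by simp
  qed (use v in auto)
  have dist: "distinct (cols A)"
    unfolding distinct_conv_nth
  proof (intro allI impI)
    fix i j assume ij: "i < length (cols A)" "j < length (cols A)" "i \<noteq> j"
    show "cols A ! i \<noteq> cols A ! j"
    proof
      assume eq: "cols A ! i = cols A ! j"
      have ij': "i < k" "j < k" using ij A by auto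
      have "(transpose_mat A * A) $$ (i, i) = (transpose_mat A * A) $$ (i, j)"
        using eq ij ij' A by simp
      then show False using pos[OF ij'(1)] ij' ij(3) unfolding gram by (simp add: mat_diag_def)
    qed
  qed
  have "lin_indpt (set (cols A))"
    using lin_depE[OF A _ dist] inj by metis
  then show ?thesis by (rule lin_indpt_full_rank[OF A dist])
qed

lemma compact_singular_value_decomposition:
  assumes X: "X \<in> carrier_mat n1 n2" and rank: "mat_rank X = r" and r: "1 \<le> r"
  shows "\<exists>A B. A \<in> carrier_mat n1 r \<and> B \<in> carrier_mat n2 r \<and> X = A * transpose_mat B \<and>
    transpose_mat B * B = 1\<^sub>m r \<and> 0 < singular_value r X \<and>
    (\<forall>Y. dim_row Y = r \<longrightarrow> singular_value r X * frob_norm Y \<le> frob_norm (A * Y))"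
proof -
  define G where "G = transpose_mat X * X"
  have G: "G \<in> carrier_mat n2 n2" "transpose_mat G = G"
    unfolding G_def using X by (auto simp: mat_transpose_mult)
  obtain es where es: "char_poly G = (\<Prod>e\<leftarrow>es. [:- e, 1:])"
    using real_symmetric_char_poly_splits[OF G] by blast
  have "proots (\<Prod>e\<leftarrow>es. [:- e, 1:]) = mset es" for es :: "real list"
  proof (induction es)
    case (Cons e es)
    have "(\<Prod>e\<leftarrow>es. [:- e, 1:]) \<noteq> 0" by (auto simp: prod_list_zero_iff)
    then have "proots ([:- e, 1:] * (\<Prod>e\<leftarrow>es. [:- e, 1:])) = proots [:- e, 1:] + mset es"
      by (subst proots_mult) (simp_all only: Cons.IH, simp_all)
    then show ?case by (simp del: mult_pCons_left)
  qed simp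
  then have proots: "proots (char_poly G) = mset es" unfolding es .
  define ls where "ls = rev (sort es)"
  have ls: "char_poly G = (\<Prod>e\<leftarrow>ls. [:- e, 1:])"
    unfolding es ls_def by (subst (1 2) prod_mset_prod_list[symmetric]) simp
  have len: "length ls = n2"
  proof -
    have "degree (\<Prod>e\<leftarrow>ls. [:- e, 1:]) = length ls" by (rule degree_linear_factors)
    then show ?thesis using degree_monic_char_poly[OF G(1)] ls by simp
  qed
  have desc: "ls ! j \<le> ls ! i" if "i \<le> j" "j < n2" for i j
  proof -
    have "sorted_wrt (\<ge>) ls" unfolding ls_def by (simp add: sorted_wrt_rev)
    then show ?thesis using that len
      by (cases "i = j") (auto simp: sorted_wrt_iff_nth_less)
  qed
  have sv: "singular_values X = map sqrt ls"
    unfolding singular_values_def G_def[symmetric] proots ls_def by simp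
  obtain P where P: "P \<in> carrier_mat n2 n2" "transpose_mat P * P = 1\<^sub>m n2"
    "transpose_mat P * G * P = mat_diag n2 (\<lambda>i. ls ! i)"
    using real_symmetric_diagonalization[OF G ls] by blast
  have gram: "transpose_mat (X * P) * (X * P) = mat_diag n2 (\<lambda>i. ls ! i)"
    using X P by (simp add: G_def mat_transpose_mult mat_assoc)
  have r_le: "r \<le> n2"
    using vec_space.rank_le_nc[OF X] rank X by simp
  have rk: "vec_space.rank n1 X = r" using rank X by simp
  have gramk: "transpose_mat (X * first_cols k P) * (X * first_cols k P) = mat_diag k (\<lambda>i. ls ! i)"
    if k: "k \<le> n2" for k
  proof (rule eq_matI)
    fix i j assume "i < dim_row (mat_diag k (\<lambda>i. ls ! i))" "j < dim_col (mat_diag k (\<lambda>i. ls ! i))"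
    then have ij: "i < k" "j < k" by (auto simp: mat_diag_def)
    have "(transpose_mat (X * first_cols k P) * (X * first_cols k P)) $$ (i, j)
        = (transpose_mat (X * P) * (X * P)) $$ (i, j)"
      using X P k ij gram_first_cols[of k "X * P" i j] by (simp add: mult_first_cols)
    then show "(transpose_mat (X * first_cols k P) * (X * first_cols k P)) $$ (i, j)
        = mat_diag k (\<lambda>i. ls ! i) $$ (i, j)"
      unfolding gram using ij k by (simp add: mat_diag_def)
  qed (use X P in \<open>auto simp: mat_diag_def\<close>)
  have nonneg: "0 \<le> ls ! j" if j: "j < n2" for j
  proof -
    have "(transpose_mat (X * P) * (X * P)) $$ (j, j) = (\<Sum>i<n1. (X * P) $$ (i, j) * (X * P) $$ (i, j))"
      using X P j by (subst mult_mat_entry) auto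
    then have "(transpose_mat (X * P) * (X * P)) $$ (j, j) \<ge> 0" by (simp add: sum_nonneg del: index_mult_mat(1))
    then show ?thesis unfolding gram using j by (simp add: mat_diag_def)
  qed
  have cF: "X * first_cols k P \<in> carrier_mat n1 k" "transpose_mat (first_cols k P) \<in> carrier_mat k n2"
    "first_cols k P \<in> carrier_mat n2 k" for k
    using X P by auto
  have pos: "ls ! (r - 1) > 0"
  proof (rule ccontr)
    assume "\<not> ls ! (r - 1) > 0"
    then have z: "ls ! j = 0" if "r - 1 \<le> j" "j < n2" for j
      using desc[OF that] nonneg[OF that(2)] by simp
    have "X = X * first_cols (r - 1) P * transpose_mat (first_cols (r - 1) P)"
      by (rule truncated_decomposition[OF X P(1,2) _ gram]) (use r_le z in auto)
    then have "vec_space.rank n1 X \<le> r - 1"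
      using rank_mult_le_inner[OF cF(1,2), of "r - 1"] by simp
    then show False using rk r by simp
  qed
  have zero: "ls ! j = 0" if j: "r \<le> j" "j < n2" for j
  proof (rule ccontr)
    assume "ls ! j \<noteq> 0"
    then have "ls ! r > 0" using desc[OF j] nonneg[OF j(2)] by simp
    then have "ls ! i > 0" if "i < Suc r" for i
      using desc[of i r] that j by simp
    then have "vec_space.rank n1 (X * first_cols (Suc r) P) = Suc r"
      using j by (intro rank_eq_if_gram_positive_diag[OF cF(1) gramk]) auto
    then show False using rank_mult_le_left[OF X cF(3), of "Suc r"] rk by simp
  qed
  define A where "A = X * first_cols r P"
  define B where "B = first_cols r P"
  have sv_r: "singular_value r X = sqrt (ls ! (r - 1))"
    unfolding singular_value_def sv using r r_le len by simp
  have "singular_value r X * frob_norm Y \<le> frob_norm (A * Y)" if Y: "dim_row Y = r" for Y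
  proof (rule power2_le_imp_le)
    have Yc: "Y \<in> carrier_mat r (dim_col Y)" using Y by auto
    have "(frob_norm (A * Y))\<^sup>2 = finner Y (mat_diag r (\<lambda>i. ls ! i) * Y)"
      unfolding frob_norm_sq gramk[OF r_le, symmetric] A_def[symmetric]
      using X Y by (subst finner_mult_left) (auto simp: A_def mat_assoc)
    also have "\<dots> = (\<Sum>i<r. \<Sum>j<dim_col Y. ls ! i * (Y $$ (i, j))\<^sup>2)"
      unfolding finner_def mat_diag_mult_left[OF Yc] Y
      by (intro sum.cong refl) (simp add: power2_eq_square)
    also have "\<dots> \<ge> (\<Sum>i<r. \<Sum>j<dim_col Y. ls ! (r - 1) * (Y $$ (i, j))\<^sup>2)"
      by (intro sum_mono mult_right_mono desc) (use r_le in auto)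
    also have "(\<Sum>i<r. \<Sum>j<dim_col Y. ls ! (r - 1) * (Y $$ (i, j))\<^sup>2) = (singular_value r X * frob_norm Y)\<^sup>2"
      using pos Y by (simp add: sv_r power_mult_distrib frob_norm_def sum_nonneg sum_distrib_left)
    finally show "(singular_value r X * frob_norm Y)\<^sup>2 \<le> (frob_norm (A * Y))\<^sup>2" .
  qed simp
  moreover have "X = A * transpose_mat B"
    unfolding A_def B_def by (rule truncated_decomposition[OF X P(1,2) r_le gram zero])
  moreover have "transpose_mat B * B = 1\<^sub>m r"
    unfolding B_def
    by (rule eq_matI) (use P r_le gram_first_cols[of r P] in \<open>auto simp del: index_mult_mat(1)\<close>)
  ultimately show ?thesis
    using pos sv_r cF unfolding A_def B_def by (intro exI[of _ "X * first_cols r P"] exI[of _ "first_cols r P"]) auto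
qed

subsection \<open>Minimizers of the linearized least squares problem\<close>

lemma eucl_norm_L2_set:
  assumes "v \<in> carrier_vec m"
  shows "eucl_norm v = L2_set (\<lambda>i. v $ i) {..<m}"
  using assms by (simp add: eucl_norm_def L2_set_def scalar_prod_def atLeast0LessThan power2_eq_square)

lemma eucl_norm_nonneg [simp]: "0 \<le> eucl_norm v"
  by (simp add: eucl_norm_def scalar_prod_def sum_nonneg)

lemma eucl_norm_triangle:
  assumes "v \<in> carrier_vec m" "w \<in> carrier_vec m"
  shows "eucl_norm (v + w) \<le> eucl_norm v + eucl_norm w"
proof -
  have "v + w \<in> carrier_vec m" using assms by simp
  then have "eucl_norm (v + w) = L2_set (\<lambda>i. v $ i + w $ i) {..<m}"
    unfolding eucl_norm_L2_set[OF \<open>v + w \<in> carrier_vec m\<close>] using assms by (intro L2_set_cong) auto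
  then show ?thesis
    unfolding assms[THEN eucl_norm_L2_set] using L2_set_triangle_ineq by simp
qed

lemma eucl_norm_uminus: "eucl_norm (- v) = eucl_norm v"
  by (simp add: eucl_norm_def scalar_prod_def)

lemma linear_map_matD:
  assumes "linear_map class_ring (module_mat TYPE(real) n\<^sub>1 n\<^sub>2) (module_vec TYPE(real) m) \<A>"
  shows "X \<in> carrier_mat n\<^sub>1 n\<^sub>2 \<Longrightarrow> \<A> X \<in> carrier_vec m"
    and "X \<in> carrier_mat n\<^sub>1 n\<^sub>2 \<Longrightarrow> Y \<in> carrier_mat n\<^sub>1 n\<^sub>2 \<Longrightarrow> \<A> (X + Y) = \<A> X + \<A> Y"
    and "X \<in> carrier_mat n\<^sub>1 n\<^sub>2 \<Longrightarrow> Y \<in> carrier_mat n\<^sub>1 n\<^sub>2 \<Longrightarrow> \<A> (X - Y) = \<A> X - \<A> Y"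
proof -
  have hom: "\<A> \<in> module_hom class_ring (module_mat TYPE(real) n\<^sub>1 n\<^sub>2) (module_vec TYPE(real) m)"
    using assms unfolding linear_map_def mod_hom_def mod_hom_axioms_def by blast
  show c: "X \<in> carrier_mat n\<^sub>1 n\<^sub>2 \<Longrightarrow> \<A> X \<in> carrier_vec m" for X
    using hom unfolding module_hom_def module_mat_def module_vec_def by auto
  show add: "X \<in> carrier_mat n\<^sub>1 n\<^sub>2 \<Longrightarrow> Y \<in> carrier_mat n\<^sub>1 n\<^sub>2 \<Longrightarrow> \<A> (X + Y) = \<A> X + \<A> Y" for X Y
    using hom unfolding module_hom_def module_mat_def module_vec_def by simp
  show "\<A> (X - Y) = \<A> X - \<A> Y" if XY: "X \<in> carrier_mat n\<^sub>1 n\<^sub>2" "Y \<in> carrier_mat n\<^sub>1 n\<^sub>2"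
  proof -
    have d: "X - Y \<in> carrier_mat n\<^sub>1 n\<^sub>2" using XY by auto
    have "X = (X - Y) + Y" by (rule eq_matI) (use XY in auto)
    then have "\<A> X = \<A> (X - Y) + \<A> Y" using add[OF d XY(2)] by simp
    then show ?thesis using c[OF d] c[OF XY(2)] by (auto intro!: eq_vecI)
  qed
qed

definition rip_ratio :: "real \<Rightarrow> real" where
  "rip_ratio \<delta> = 2 * sqrt ((1 + \<delta>) / (1 - \<delta>))"

lemma rip_ratio_ge_2:
  assumes "0 \<le> \<delta>" "\<delta> < 1"
  shows "2 \<le> rip_ratio \<delta>"
  using assms by (simp add: rip_ratio_def field_simps)

lemma gnmr_minimizer_error_bound:
  assumes lin: "linear_map class_ring (module_mat TYPE(real) n\<^sub>1 n\<^sub>2) (module_vec TYPE(real) m) \<A>"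
    and rip: "RIP n\<^sub>1 n\<^sub>2 (2 * r) \<delta>' \<A>" and \<delta>: "\<delta>' \<le> \<delta>" "\<delta> < 1"
    and U: "U \<in> carrier_mat n\<^sub>1 r" and V: "V \<in> carrier_mat n\<^sub>2 r"
    and Z: "Z \<in> carrier_mat n\<^sub>1 r" and W: "W \<in> carrier_mat n\<^sub>2 r"
    and X: "X = (U + Z) * transpose_mat (V + W)"
    and min: "gnmr_minimizer n\<^sub>1 n\<^sub>2 r \<A> (\<A> X) U V (\<Delta>U, \<Delta>V)"
  shows "frob_norm (U * transpose_mat (\<Delta>V - W) + (\<Delta>U - Z) * transpose_mat V)
    \<le> rip_ratio \<delta> * frob_norm (Z * transpose_mat W)"
proof -
  define M where "M = U * transpose_mat (\<Delta>V - W) + (\<Delta>U - Z) * transpose_mat V"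
  define E where "E = Z * transpose_mat W"
  have \<Delta>: "\<Delta>U \<in> carrier_mat n\<^sub>1 r" "\<Delta>V \<in> carrier_mat n\<^sub>2 r"
    using min by (auto simp: gnmr_minimizer_def is_arg_min_def)
  have cX: "X \<in> carrier_mat n\<^sub>1 n\<^sub>2" unfolding X using U V Z W by auto
  have cM: "M \<in> carrier_mat n\<^sub>1 n\<^sub>2" unfolding M_def using U V Z W \<Delta> by auto
  have cE: "E \<in> carrier_mat n\<^sub>1 n\<^sub>2" unfolding E_def using Z W by auto
  note dims = carrier_matD[OF U] carrier_matD[OF V] carrier_matD[OF Z] carrier_matD[OF W]
    carrier_matD[OF \<Delta>(1)] carrier_matD[OF \<Delta>(2)]
  note A = linear_map_matD[OF lin]
  have res: "eucl_norm (\<A> (M + X - E) - \<A> X) = eucl_norm (\<A> M - \<A> E)"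
  proof -
    have "\<A> (M + X - E) = \<A> M + \<A> X - \<A> E" using cM cX cE by (simp add: A)
    then have "\<A> (M + X - E) - \<A> X = \<A> M - \<A> E"
      using A(1)[OF cM] A(1)[OF cE] A(1)[OF cX] by (auto intro!: eq_vecI)
    then show ?thesis by simp
  qed
  have res0: "eucl_norm (\<A> (X - E) - \<A> X) = eucl_norm (\<A> E)"
  proof -
    have "\<A> (X - E) - \<A> X = - \<A> E"
      unfolding A(3)[OF cX cE] using A(1)[OF cE] A(1)[OF cX] by (auto intro!: eq_vecI)
    then show ?thesis by (simp add: eucl_norm_uminus)
  qed
  have "U * transpose_mat V + U * transpose_mat \<Delta>V + \<Delta>U * transpose_mat V = M + X - E"
    unfolding M_def X E_def
    by (rule eq_matI) (auto simp: mat_ring_simps dims simp del: index_mult_mat(1))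
  then have loss: "gnmr_loss \<A> (\<A> X) U V (\<Delta>U, \<Delta>V) = (eucl_norm (\<A> M - \<A> E))\<^sup>2"
    by (simp add: gnmr_loss_def res)
  have "U * transpose_mat V + U * transpose_mat W + Z * transpose_mat V = X - E"
    unfolding X E_def
    by (rule eq_matI) (auto simp: mat_ring_simps dims simp del: index_mult_mat(1))
  then have "gnmr_loss \<A> (\<A> X) U V (Z, W) = (eucl_norm (\<A> E))\<^sup>2"
    by (simp add: gnmr_loss_def res0)
  then have "(eucl_norm (\<A> M - \<A> E))\<^sup>2 \<le> (eucl_norm (\<A> E))\<^sup>2"
    using min Z W loss unfolding gnmr_minimizer_def is_arg_min_def
    by (metis (no_types, lifting) mem_Sigma_iff not_le)
  then have le: "eucl_norm (\<A> M - \<A> E) \<le> eucl_norm (\<A> E)"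
    by (rule power2_le_imp_le) simp
  have "eucl_norm (\<A> M) \<le> eucl_norm (\<A> M - \<A> E) + eucl_norm (\<A> E)"
  proof -
    have "\<A> M = (\<A> M - \<A> E) + \<A> E"
      using A(1)[OF cM] A(1)[OF cE] by (auto intro!: eq_vecI)
    then show ?thesis
      using eucl_norm_triangle[of "\<A> M - \<A> E" m "\<A> E"] A(1)[OF cM] A(1)[OF cE] by simp
  qed
  with le have "(eucl_norm (\<A> M))\<^sup>2 \<le> (2 * eucl_norm (\<A> E))\<^sup>2"
    by (intro power_mono) auto
  then have sq: "(eucl_norm (\<A> M))\<^sup>2 \<le> 4 * (eucl_norm (\<A> E))\<^sup>2"
    by (simp add: power_mult_distrib)
  have "vec_space.rank n\<^sub>1 (U * transpose_mat (\<Delta>V - W)) \<le> r"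
    by (rule rank_mult_le_inner[of _ _ _ _ n\<^sub>2]) (use U W \<Delta> in auto)
  moreover have "vec_space.rank n\<^sub>1 ((\<Delta>U - Z) * transpose_mat V) \<le> r"
    by (rule rank_mult_le_inner[of _ _ _ _ n\<^sub>2]) (use V Z \<Delta> in auto)
  moreover have "vec_space.rank n\<^sub>1 M \<le> vec_space.rank n\<^sub>1 (U * transpose_mat (\<Delta>V - W))
      + vec_space.rank n\<^sub>1 ((\<Delta>U - Z) * transpose_mat V)"
    unfolding M_def by (rule vec_space.rank_subadditive[of _ _ n\<^sub>2]) (use U V Z W \<Delta> in auto)
  ultimately have rM: "mat_rank M \<le> 2 * r" using cM by simp
  have "vec_space.rank n\<^sub>1 E \<le> r"
    unfolding E_def by (rule rank_mult_le_inner[of _ _ _ _ n\<^sub>2]) (use W Z in auto)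
  then have rE: "mat_rank E \<le> 2 * r" using cE by simp
  have "0 \<le> \<delta>'" using rip by (simp add: RIP_def)
  have "(1 - \<delta>) * (frob_norm M)\<^sup>2 \<le> (1 - \<delta>') * (frob_norm M)\<^sup>2"
    using \<delta> by (intro mult_right_mono) auto
  also have "\<dots> \<le> (eucl_norm (\<A> M))\<^sup>2"
    using rip cM rM unfolding RIP_def by blast
  also have "\<dots> \<le> 4 * (eucl_norm (\<A> E))\<^sup>2" by (rule sq)
  also have "\<dots> \<le> 4 * ((1 + \<delta>') * (frob_norm E)\<^sup>2)"
    using rip cE rE unfolding RIP_def by simp
  also have "\<dots> \<le> 4 * ((1 + \<delta>) * (frob_norm E)\<^sup>2)"
    using \<delta> by (intro mult_left_mono mult_right_mono) auto
  finally have "(frob_norm M)\<^sup>2 \<le> 4 * ((1 + \<delta>) / (1 - \<delta>)) * (frob_norm E)\<^sup>2"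
    using \<delta> by (simp add: field_simps)
  also have "\<dots> = (rip_ratio \<delta> * frob_norm E)\<^sup>2"
    using \<delta> \<open>0 \<le> \<delta>'\<close> by (simp add: rip_ratio_def power_mult_distrib)
  finally have "frob_norm M \<le> rip_ratio \<delta> * frob_norm E"
    by (rule power2_le_imp_le) (use \<delta> \<open>0 \<le> \<delta>'\<close> rip_ratio_ge_2[of \<delta>] in auto)
  then show ?thesis unfolding M_def E_def .
qed

text \<open>The linearization is constant along \<open>(\<Delta>U - t U G, \<Delta>V + t V G\<^sup>T)\<close>, so a minimal norm solution
  is orthogonal to \<open>(U G, - V G\<^sup>T)\<close> for every \<open>G\<close>.\<close>

lemma gnmr_update_balanced:
  assumes U: "U \<in> carrier_mat n\<^sub>1 r" and V: "V \<in> carrier_mat n\<^sub>2 r"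
    and upd: "gnmr_update n\<^sub>1 n\<^sub>2 r \<A> b U V (\<Delta>U, \<Delta>V)"
  shows "transpose_mat U * \<Delta>U = transpose_mat \<Delta>V * V"
proof -
  have min: "gnmr_minimizer n\<^sub>1 n\<^sub>2 r \<A> b U V (\<Delta>U, \<Delta>V)"
    using upd by (simp add: gnmr_update_def is_arg_min_def)
  then have \<Delta>: "\<Delta>U \<in> carrier_mat n\<^sub>1 r" "\<Delta>V \<in> carrier_mat n\<^sub>2 r"
    by (auto simp: gnmr_minimizer_def is_arg_min_def)
  note dims = carrier_matD[OF U] carrier_matD[OF V] carrier_matD[OF \<Delta>(1)] carrier_matD[OF \<Delta>(2)]
  define G where "G = transpose_mat U * \<Delta>U - transpose_mat \<Delta>V * V"
  have G: "G \<in> carrier_mat r r" unfolding G_def using U V \<Delta> by auto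
  define g where "g = finner G G"
  define K where "K = finner (U * G) (U * G) + finner (V * transpose_mat G) (V * transpose_mat G)"
  have K: "0 \<le> K" unfolding K_def by (simp flip: frob_norm_sq)
  have g: "finner \<Delta>U (U * G) - finner \<Delta>V (V * transpose_mat G) = g"
  proof -
    have "finner \<Delta>U (U * G) = finner (transpose_mat U * \<Delta>U) G"
      using finner_mult_left[of "transpose_mat U" \<Delta>U G] dims carrier_matD[OF G] by simp
    moreover have "finner \<Delta>V (V * transpose_mat G) = finner (transpose_mat V * \<Delta>V) (transpose_mat G)"
      using finner_mult_left[of "transpose_mat V" \<Delta>V "transpose_mat G"] dims carrier_matD[OF G] by simp
    moreover have "finner (transpose_mat V * \<Delta>V) (transpose_mat G) = finner (transpose_mat \<Delta>V * V) G"
      using finner_transpose[of "transpose_mat \<Delta>V * V" G] dims carrier_matD[OF G]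
      by (simp add: mat_transpose_mult)
    moreover have "g = finner (transpose_mat U * \<Delta>U) G - finner (transpose_mat \<Delta>V * V) G"
      unfolding g_def by (subst (1) G_def, subst finner_minus_left) (use dims carrier_matD[OF G] in auto)
    ultimately show ?thesis by simp
  qed
  have ineq: "2 * t * g \<le> t\<^sup>2 * K" for t
  proof -
    define U' where "U' = \<Delta>U - t \<cdot>\<^sub>m (U * G)"
    define V' where "V' = \<Delta>V + t \<cdot>\<^sub>m (V * transpose_mat G)"
    have c: "U' \<in> carrier_mat n\<^sub>1 r" "V' \<in> carrier_mat n\<^sub>2 r"
      unfolding U'_def V'_def using U V \<Delta> G by auto
    have "U * transpose_mat V + U * transpose_mat V' + U' * transpose_mat V
        = U * transpose_mat V + U * transpose_mat \<Delta>V + \<Delta>U * transpose_mat V"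
      unfolding U'_def V'_def
      by (rule eq_matI) (auto simp: mat_ring_simps dims carrier_matD[OF G] simp del: index_mult_mat(1))
    then have "gnmr_loss \<A> b U V (U', V') = gnmr_loss \<A> b U V (\<Delta>U, \<Delta>V)"
      by (simp add: gnmr_loss_def)
    then have "gnmr_minimizer n\<^sub>1 n\<^sub>2 r \<A> b U V (U', V')"
      using min c by (simp add: gnmr_minimizer_def is_arg_min_def)
    then have "(frob_norm \<Delta>U)\<^sup>2 + (frob_norm \<Delta>V)\<^sup>2 \<le> (frob_norm U')\<^sup>2 + (frob_norm V')\<^sup>2"
      using upd unfolding gnmr_update_def is_arg_min_def by force
    moreover have "(frob_norm U')\<^sup>2 = (frob_norm \<Delta>U)\<^sup>2 - 2 * t * finner \<Delta>U (U * G) + t\<^sup>2 * finner (U * G) (U * G)"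
      unfolding U'_def frob_norm_sq using dims carrier_matD[OF G] finner_commute[of \<Delta>U "U * G"]
      by (simp add: finner_simps algebra_simps power2_eq_square)
    moreover have "(frob_norm V')\<^sup>2 = (frob_norm \<Delta>V)\<^sup>2 + 2 * t * finner \<Delta>V (V * transpose_mat G)
        + t\<^sup>2 * finner (V * transpose_mat G) (V * transpose_mat G)"
      unfolding V'_def frob_norm_sq using dims carrier_matD[OF G] finner_commute[of \<Delta>V "V * transpose_mat G"]
      by (simp add: finner_simps algebra_simps power2_eq_square)
    ultimately show ?thesis unfolding K_def g[symmetric] by (simp add: algebra_simps)
  qed
  define s where "s = g / (K + 1)"
  have gs: "g = s * (K + 1)" using K by (simp add: s_def)
  have "s * s * (K + 2) \<le> 0"
    using ineq[of s] unfolding gs by (simp add: power2_eq_square algebra_simps)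
  then have "s = 0" using K by (auto simp: mult_le_0_iff)
  then have "g = 0" by (simp add: gs)
  then have "G = 0\<^sub>m r r" using finner_self_eq_0D[of G] G unfolding g_def by simp
  then have G0: "G $$ (i, j) = 0" if "i < r" "j < r" for i j using that by simp
  show ?thesis
    by (rule eq_matI) (use G0 dims in \<open>auto simp: G_def simp del: index_mult_mat(1)\<close>)
qed

subsection \<open>One step from a nearly balanced, nearly exact factorization\<close>

lemma real_mat_inverse_exists:
  fixes N :: "real mat"
  assumes N: "N \<in> carrier_mat r r"
    and inj: "\<And>Y. Y \<in> carrier_mat r 1 \<Longrightarrow> N * Y = 0\<^sub>m r 1 \<Longrightarrow> frob_norm Y = 0"
  shows "\<exists>N'. N' \<in> carrier_mat r r \<and> N * N' = 1\<^sub>m r \<and> N' * N = 1\<^sub>m r"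
proof -
  have "det N \<noteq> 0"
  proof
    assume "det N = 0"
    then obtain v where v: "v \<in> carrier_vec r" "v \<noteq> 0\<^sub>v r" "N *\<^sub>v v = 0\<^sub>v r"
      unfolding det_0_iff_vec_prod_zero_field[OF N] by blast
    define Y where "Y = mat r 1 (\<lambda>(i, j). v $ i)"
    have Y: "Y \<in> carrier_mat r 1" unfolding Y_def by simp
    have "N * Y = 0\<^sub>m r 1"
    proof (rule eq_matI)
      fix i j assume "i < dim_row (0\<^sub>m r 1 :: real mat)" "j < dim_col (0\<^sub>m r 1 :: real mat)"
      then have ij: "i < r" "j = 0" by auto
      have "(N * Y) $$ (i, j) = (\<Sum>k<r. N $$ (i, k) * v $ k)"
        using N ij by (subst mult_mat_entry) (auto simp: Y_def)
      also have "\<dots> = (N *\<^sub>v v) $ i"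
        using N v(1) ij by (auto simp: scalar_prod_def atLeast0LessThan intro!: sum.cong)
      finally show "(N * Y) $$ (i, j) = 0\<^sub>m r 1 $$ (i, j)"
        using ij by (simp add: v(3))
    qed (use N Y in auto)
    then have "finner Y Y = 0" using inj[OF Y] by (simp flip: frob_norm_sq)
    then have Y0: "Y = 0\<^sub>m r 1" using finner_self_eq_0D[of Y] Y by simp
    have "v = 0\<^sub>v r"
    proof (rule eq_vecI)
      fix i assume "i < dim_vec (0\<^sub>v r :: real vec)"
      then show "v $ i = 0\<^sub>v r $ i"
        using arg_cong[OF Y0, of "\<lambda>M. M $$ (i, 0)"] by (simp add: Y_def)
    qed (use v in simp)
    then show False using v(2) by simp
  qed
  from det_non_zero_imp_unit[OF N this, of "()"] show ?thesis
    unfolding Units_def by (auto simp: ring_mat_simps)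
qed

lemma frob_norm_minus_projection_le:
  assumes BB: "transpose_mat B * B = 1\<^sub>m (dim_col B)" and dim: "dim_col R = dim_row B"
  shows "frob_norm (R - R * B * transpose_mat B) \<le> frob_norm R"
proof (rule power2_le_imp_le)
  let ?P = "R * B * transpose_mat B"
  have PP: "finner ?P ?P = finner (R * B) (R * B)"
    using dim BB by (subst finner_mult_right) (auto simp: mat_assoc mat_mult_one)
  have RP: "finner R ?P = finner (R * B) (R * B)"
    using dim by (subst finner_commute, simp, simp, subst finner_mult_right) auto
  have "(frob_norm (R - ?P))\<^sup>2 = finner R R - 2 * finner R ?P + finner ?P ?P"
    unfolding frob_norm_sq using dim finner_commute[of R ?P] by (simp add: finner_simps)
  also have "\<dots> \<le> (frob_norm R)\<^sup>2"
    unfolding PP RP frob_norm_sq by (simp flip: frob_norm_sq)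
  finally show "(frob_norm (R - ?P))\<^sup>2 \<le> (frob_norm R)\<^sup>2" .
qed simp

locale near_factorization =
  fixes n\<^sub>1 n\<^sub>2 r :: nat and A B U V X :: "real mat" and \<sigma> :: real
  assumes A: "A \<in> carrier_mat n\<^sub>1 r" and B: "B \<in> carrier_mat n\<^sub>2 r"
    and U: "U \<in> carrier_mat n\<^sub>1 r" and V: "V \<in> carrier_mat n\<^sub>2 r"
    and X_eq: "X = A * transpose_mat B" and BB: "transpose_mat B * B = 1\<^sub>m r"
    and \<sigma>_pos: "0 < \<sigma>"
    and \<sigma>_le: "\<And>Y. dim_row Y = r \<Longrightarrow> \<sigma> * frob_norm Y \<le> frob_norm (A * Y)"
    and err: "frob_norm (U * transpose_mat V - X) \<le> \<sigma> / 32"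
    and bal: "frob_norm (transpose_mat U * U - transpose_mat V * V) \<le> \<sigma> / 32"
begin

definition "R = U * transpose_mat V - X"
definition "e = frob_norm R"
definition "N = transpose_mat V * B"
definition "q = sqrt (\<sigma> / 2)"

lemma q: "0 < q" "q * q = \<sigma> / 2"
  using \<sigma>_pos by (simp_all add: q_def)

lemma e: "0 \<le> e" "e \<le> \<sigma> / 32"
  using err by (simp_all add: e_def R_def)

lemma dims [simp]: "dim_row A = n\<^sub>1" "dim_col A = r" "dim_row B = n\<^sub>2" "dim_col B = r"
  "dim_row U = n\<^sub>1" "dim_col U = r" "dim_row V = n\<^sub>2" "dim_col V = r"
  "dim_row X = n\<^sub>1" "dim_col X = n\<^sub>2" "dim_row R = n\<^sub>1" "dim_col R = n\<^sub>2"
  "dim_row N = r" "dim_col N = r"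
  using A B U V unfolding R_def N_def unfolding X_eq by auto

lemma frob_norm_R_B: "frob_norm (R * B) \<le> e"
  using frob_norm_coisometry_le[of B "transpose_mat R"] BB
    frob_norm_transpose[of "R * B"] by (simp add: e_def mat_transpose_mult)

lemma U_N: "U * N = A + R * B"
proof -
  have "X * B = A" unfolding X_eq using BB by (simp add: mat_assoc mat_mult_one)
  moreover have "U * N = (X + R) * B"
  proof -
    have "X + R = U * transpose_mat V" by (rule eq_matI) (auto simp: R_def simp del: index_mult_mat(1))
    then show ?thesis by (simp add: N_def mat_assoc)
  qed
  ultimately show ?thesis by (simp add: mat_add_mult)
qed

lemma U_N_ge:
  assumes [simp]: "dim_row Y = r"
  shows "31 / 32 * \<sigma> * frob_norm Y \<le> frob_norm (U * N * Y)"
proof -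
  have "A * Y = U * N * Y - R * B * Y"
    unfolding U_N by (rule eq_matI) (auto simp: mat_add_mult simp del: index_mult_mat(1))
  then have "frob_norm (A * Y) \<le> frob_norm (U * N * Y) + frob_norm (R * B * Y)"
    using frob_norm_triangle_minus[of "U * N * Y" "R * B * Y"] by simp
  moreover have "frob_norm (R * B * Y) \<le> e * frob_norm Y"
    using frob_norm_mult_le[of "R * B" Y] mult_right_mono[OF frob_norm_R_B, of "frob_norm Y"] by simp
  moreover have "e * frob_norm Y \<le> \<sigma> / 32 * frob_norm Y"
    using e by (intro mult_right_mono) auto
  ultimately show ?thesis using \<sigma>_le[of Y] by simp
qed

lemma N_inverse: "\<exists>N'. N' \<in> carrier_mat r r \<and> N * N' = 1\<^sub>m r \<and> N' * N = 1\<^sub>m r"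
proof (rule real_mat_inverse_exists)
  fix Y assume Y: "Y \<in> carrier_mat r 1" "N * Y = 0\<^sub>m r 1"
  have "U * N * Y = 0\<^sub>m n\<^sub>1 1" using Y U by (simp add: mat_assoc)
  moreover have "frob_norm (0\<^sub>m n\<^sub>1 1) = 0" by (simp add: frob_norm_def)
  ultimately have "31 / 32 * \<sigma> * frob_norm Y \<le> 0" using U_N_ge[of Y] Y by simp
  then show "frob_norm Y = 0" using \<sigma>_pos frob_norm_nonneg[of Y]
    by (auto simp: mult_le_0_iff)
qed auto

text \<open>Writing \<open>D = V\<^sup>T B N\<^sup>-\<^sup>1 D\<close> bounds \<open>\<parallel>D\<parallel>\<^sup>2\<close> by \<open>\<parallel>U D\<parallel> \<parallel>V D\<parallel>\<close>; balancedness then makes both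
  factors comparable.\<close>

lemma frob_norm_mult_ge:
  assumes [simp]: "dim_row D = r"
  shows "q * frob_norm D \<le> frob_norm (U * D)" "q * frob_norm D \<le> frob_norm (V * D)"
proof -
  obtain N' where N': "N' \<in> carrier_mat r r" "N * N' = 1\<^sub>m r" using N_inverse by blast
  have [simp]: "dim_row N' = r" "dim_col N' = r" using N' by auto
  define C where "C = N' * D"
  have [simp]: "dim_row C = r" "dim_col C = dim_col D" by (simp_all add: C_def)
  have NC: "N * C = D" unfolding C_def using N'(2) by (simp add: mat_one_mult flip: mat_assoc)
  define a b d where "a = frob_norm (U * D)" and "b = frob_norm (V * D)" and "d = frob_norm D"
  have nn: "0 \<le> a" "0 \<le> b" "0 \<le> d" by (simp_all add: a_def b_def d_def)
  have C_le: "31 / 32 * \<sigma> * frob_norm C \<le> a"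
    using U_N_ge[of C] by (simp add: a_def mat_assoc NC)
  have "d\<^sup>2 = finner (N * C) D" by (simp add: d_def frob_norm_sq NC)
  also have "\<dots> = finner (B * C) (V * D)"
    unfolding N_def by (subst mat_assoc) (simp_all add: finner_mult_left)
  also have "\<dots> \<le> frob_norm (B * C) * b"
    using finner_le_frob[of "B * C" "V * D"] by (simp add: b_def)
  also have "frob_norm (B * C) = frob_norm C" using BB by (intro frob_norm_isometry) auto
  finally have "31 / 32 * \<sigma> * d\<^sup>2 \<le> 31 / 32 * \<sigma> * (frob_norm C * b)"
    using \<sigma>_pos by (intro mult_left_mono) auto
  also have "\<dots> \<le> a * b"
    using mult_right_mono[OF C_le nn(2)] by (simp add: mult.assoc)
  finally have ab: "31 / 32 * \<sigma> * d\<^sup>2 \<le> a * b" .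
  have "a\<^sup>2 - b\<^sup>2 = finner D ((transpose_mat U * U - transpose_mat V * V) * D)"
    unfolding a_def b_def frob_norm_sq
    by (simp add: finner_mult_left mat_assoc mat_minus_mult finner_minus_right)
  moreover have "\<bar>\<dots>\<bar> \<le> d * (\<sigma> / 32 * d)"
  proof -
    have "frob_norm ((transpose_mat U * U - transpose_mat V * V) * D) \<le> \<sigma> / 32 * d"
      using frob_norm_mult_le[of "transpose_mat U * U - transpose_mat V * V" D]
        mult_right_mono[OF bal nn(3)] by (simp add: d_def)
    then show ?thesis
      using finner_le_frob[of D "(transpose_mat U * U - transpose_mat V * V) * D"]
        mult_left_mono[OF _ nn(3)] by (fastforce simp: d_def)
  qed
  ultimately have diff: "\<bar>a\<^sup>2 - b\<^sup>2\<bar> \<le> \<sigma> / 32 * d\<^sup>2"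
    by (simp add: power2_eq_square mult_ac)
  have *: "\<sigma> / 2 * d\<^sup>2 \<le> x\<^sup>2" if xy: "0 \<le> x" "0 \<le> y" "31 / 32 * \<sigma> * d\<^sup>2 \<le> x * y" "\<bar>x\<^sup>2 - y\<^sup>2\<bar> \<le> \<sigma> / 32 * d\<^sup>2" for x y
  proof (rule ccontr)
    assume less: "\<not> \<sigma> / 2 * d\<^sup>2 \<le> x\<^sup>2"
    define s where "s = \<sigma> * d\<^sup>2"
    have s: "0 < s" using less zero_le_power2[of x] unfolding s_def by linarith
    have "2 * (x * y) \<le> x\<^sup>2 + y\<^sup>2"
      using sum_squares_bound[of x y] by (simp add: mult.assoc)
    moreover have "x\<^sup>2 + y\<^sup>2 \<le> s / 2 + s / 2 + s / 32" using xy(4) less unfolding s_def abs_le_iff by linarith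
    moreover have "31 / 32 * s \<le> x * y" using xy(3) by (simp add: s_def)
    ultimately show False using s by simp
  qed
  have sq: "(q * d)\<^sup>2 = \<sigma> / 2 * d\<^sup>2" using q by (simp add: power_mult_distrib power2_eq_square)
  show "q * frob_norm D \<le> frob_norm (U * D)"
    using *[of a b] nn ab diff power2_le_imp_le[of "q * d" a] sq by (simp add: a_def d_def)
  show "q * frob_norm D \<le> frob_norm (V * D)"
    using *[of b a] nn ab diff power2_le_imp_le[of "q * d" b] sq
    by (simp add: b_def d_def mult.commute abs_minus_commute)
qed

lemma frob_norm_R_projection: "frob_norm (R * B * transpose_mat B) \<le> e"
proof -
  have "frob_norm (R * B * transpose_mat B) = frob_norm (transpose_mat (R * B * transpose_mat B))"
    by simp
  also have "\<dots> = frob_norm (B * transpose_mat (R * B))"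
    by (simp add: mat_transpose_mult del: frob_norm_transpose)
  also have "\<dots> = frob_norm (transpose_mat (R * B))"
    using BB by (intro frob_norm_isometry) auto
  also have "\<dots> \<le> e" using frob_norm_R_B by simp
  finally show ?thesis .
qed

text \<open>The exact factors are \<open>U + Z = A N\<^sup>-\<^sup>1\<close> and \<open>V + W = B N\<^sup>T\<close>, where \<open>N = V\<^sup>T B\<close>.\<close>

lemma nearby_exact_factors:
  "\<exists>Z W. Z \<in> carrier_mat n\<^sub>1 r \<and> W \<in> carrier_mat n\<^sub>2 r \<and> X = (U + Z) * transpose_mat (V + W) \<and>
    q * frob_norm Z \<le> 2 * e \<and> q * frob_norm W \<le> e"
proof -
  obtain N' where N': "N' \<in> carrier_mat r r" "N' * N = 1\<^sub>m r" using N_inverse by blast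
  have [simp]: "dim_row N' = r" "dim_col N' = r" using N' by auto
  define Z where "Z = A * N' - U"
  define W where "W = B * transpose_mat N - V"
  have [simp]: "dim_row Z = n\<^sub>1" "dim_col Z = r" "dim_row W = n\<^sub>2" "dim_col W = r"
    by (simp_all add: Z_def W_def)
  have UZ: "U + Z = A * N'" by (rule eq_matI) (auto simp: Z_def simp del: index_mult_mat(1))
  have VW: "V + W = B * transpose_mat N" by (rule eq_matI) (auto simp: W_def simp del: index_mult_mat(1))
  have VWT: "transpose_mat (V + W) = N * transpose_mat B" by (simp add: VW mat_transpose_mult)
  have "(U + Z) * transpose_mat (V + W) = A * ((N' * N) * transpose_mat B)"
    unfolding UZ VWT by (simp add: mat_assoc)
  then have X_UZVW: "X = (U + Z) * transpose_mat (V + W)"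
    unfolding N'(2) by (simp add: X_eq mat_one_mult)
  have U_VW: "U * transpose_mat (V + W) = X + R * B * transpose_mat B"
  proof -
    have "U * transpose_mat (V + W) = (U * N) * transpose_mat B" by (simp add: VWT mat_assoc)
    then show ?thesis unfolding U_N by (simp add: mat_add_mult flip: X_eq)
  qed
  have UV: "U * transpose_mat V = X + R"
    by (rule eq_matI) (auto simp: R_def simp del: index_mult_mat(1))
  have "U * transpose_mat W = U * transpose_mat (V + W) - U * transpose_mat V"
    by (rule eq_matI) (auto simp: mat_ring_simps simp del: index_mult_mat(1))
  also have "\<dots> = R * B * transpose_mat B - R"
    unfolding U_VW UV by (rule eq_matI) (auto simp del: index_mult_mat(1))
  finally have "frob_norm (U * transpose_mat W) = frob_norm (R - R * B * transpose_mat B)"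
    by (simp add: frob_norm_minus_commute)
  also have "\<dots> \<le> e"
    unfolding e_def using BB by (intro frob_norm_minus_projection_le) auto
  finally have W: "q * frob_norm W \<le> e"
    using frob_norm_mult_ge(1)[of "transpose_mat W"] by simp
  have "X - U * transpose_mat (V + W) = Z * transpose_mat (V + W)"
    unfolding X_UZVW by (rule eq_matI) (auto simp: mat_ring_simps simp del: index_mult_mat(1))
  then have "Z * transpose_mat (V + W) = X - (X + R * B * transpose_mat B)"
    unfolding U_VW by simp
  also have "\<dots> = (-1) \<cdot>\<^sub>m (R * B * transpose_mat B)"
    by (rule eq_matI) (auto simp del: index_mult_mat(1))
  finally have "frob_norm (Z * transpose_mat (V + W)) \<le> e"
    using frob_norm_R_projection by (simp add: frob_norm_smult)
  moreover have "frob_norm (Z * transpose_mat V) \<le> frob_norm (Z * transpose_mat (V + W)) + frob_norm (Z * transpose_mat W)"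
  proof -
    have "Z * transpose_mat V = Z * transpose_mat (V + W) - Z * transpose_mat W"
      by (rule eq_matI) (auto simp: mat_ring_simps simp del: index_mult_mat(1))
    then show ?thesis
      using frob_norm_triangle_minus[of "Z * transpose_mat (V + W)" "Z * transpose_mat W"] by simp
  qed
  moreover have "frob_norm (Z * transpose_mat W) \<le> frob_norm Z * frob_norm W"
    using frob_norm_mult_le[of Z "transpose_mat W"] by simp
  moreover have "q * frob_norm Z \<le> frob_norm (Z * transpose_mat V)"
    using frob_norm_mult_ge(2)[of "transpose_mat Z"] frob_norm_transpose[of "Z * transpose_mat V"]
    by (simp add: mat_transpose_mult)
  moreover have "frob_norm Z * frob_norm W \<le> frob_norm Z * (q / 2)"
  proof (rule mult_left_mono)
    have "q * (q / 2) = \<sigma> / 4" using q(2) by simp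
    then have "q * frob_norm W \<le> q * (q / 2)" using W e(2) \<sigma>_pos by linarith
    then show "frob_norm W \<le> q / 2" using q(1) by (simp only: mult_le_cancel_left_pos)
  qed simp
  ultimately have "q * frob_norm Z \<le> e + frob_norm Z * (q / 2)" by linarith
  then have "q * frob_norm Z \<le> 2 * e" by (simp add: mult.commute)
  then show ?thesis using X_UZVW W by (intro exI[of _ Z] exI[of _ W]) auto
qed

lemma linearization_ge:
  assumes [simp]: "dim_row \<Delta>U = n\<^sub>1" "dim_col \<Delta>U = r" "dim_row \<Delta>V = n\<^sub>2" "dim_col \<Delta>V = r"
    and balanced: "transpose_mat U * \<Delta>U = transpose_mat \<Delta>V * V"
  shows "\<sigma> / 2 * ((frob_norm \<Delta>U)\<^sup>2 + (frob_norm \<Delta>V)\<^sup>2)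
    \<le> (frob_norm (U * transpose_mat \<Delta>V + \<Delta>U * transpose_mat V))\<^sup>2"
proof -
  let ?P = "U * transpose_mat \<Delta>V" and ?Q = "\<Delta>U * transpose_mat V"
  have "finner ?P ?Q = finner (transpose_mat \<Delta>V) ((transpose_mat U * \<Delta>U) * transpose_mat V)"
    by (simp add: finner_mult_left mat_assoc)
  also have "\<dots> = finner (transpose_mat \<Delta>V * V) (transpose_mat \<Delta>V * V)"
    unfolding balanced by (subst finner_mult_right) simp_all
  finally have cross: "0 \<le> finner ?P ?Q" by (simp flip: frob_norm_sq)
  have "(q * frob_norm \<Delta>V)\<^sup>2 \<le> (frob_norm ?P)\<^sup>2"
    using frob_norm_mult_ge(1)[of "transpose_mat \<Delta>V"] q(1) by (intro power_mono) auto
  moreover have "(q * frob_norm \<Delta>U)\<^sup>2 \<le> (frob_norm ?Q)\<^sup>2"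
    using frob_norm_mult_ge(2)[of "transpose_mat \<Delta>U"] q(1) frob_norm_transpose[of ?Q]
    by (intro power_mono) (auto simp: mat_transpose_mult)
  moreover have "(frob_norm (?P + ?Q))\<^sup>2 = (frob_norm ?P)\<^sup>2 + 2 * finner ?P ?Q + (frob_norm ?Q)\<^sup>2"
    unfolding frob_norm_sq using finner_commute[of ?P ?Q] by (simp add: finner_simps)
  moreover have "(q * x)\<^sup>2 = \<sigma> / 2 * x\<^sup>2" for x
    using q(2) by (simp add: power_mult_distrib power2_eq_square)
  ultimately show ?thesis using cross by (simp add: distrib_left)
qed

lemma step_bounds:
  assumes \<Delta> [simp]: "dim_row \<Delta>U = n\<^sub>1" "dim_col \<Delta>U = r" "dim_row \<Delta>V = n\<^sub>2" "dim_col \<Delta>V = r"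
    and balanced: "transpose_mat U * \<Delta>U = transpose_mat \<Delta>V * V"
    and ZW: "Z \<in> carrier_mat n\<^sub>1 r" "W \<in> carrier_mat n\<^sub>2 r" "X = (U + Z) * transpose_mat (V + W)"
      "q * frob_norm Z \<le> 2 * e" "q * frob_norm W \<le> e"
    and \<kappa>: "0 \<le> \<kappa>" "4 * (\<kappa> + 1) * e \<le> \<sigma>"
    and M: "frob_norm (U * transpose_mat (\<Delta>V - W) + (\<Delta>U - Z) * transpose_mat V)
      \<le> \<kappa> * frob_norm (Z * transpose_mat W)"
  shows "\<sigma> * ((frob_norm \<Delta>U)\<^sup>2 + (frob_norm \<Delta>V)\<^sup>2) \<le> 8 * e\<^sup>2"
    and "\<sigma> * frob_norm ((U + \<Delta>U) * transpose_mat (V + \<Delta>V) - X) \<le> 4 * (\<kappa> + 2) * e\<^sup>2"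
proof -
  have [simp]: "dim_row Z = n\<^sub>1" "dim_col Z = r" "dim_row W = n\<^sub>2" "dim_col W = r"
    using ZW by auto
  define E where "E = Z * transpose_mat W"
  define M' where "M' = U * transpose_mat (\<Delta>V - W) + (\<Delta>U - Z) * transpose_mat V"
  define L where "L = U * transpose_mat \<Delta>V + \<Delta>U * transpose_mat V"
  define S where "S = (frob_norm \<Delta>U)\<^sup>2 + (frob_norm \<Delta>V)\<^sup>2"
  have [simp]: "dim_row E = n\<^sub>1" "dim_col E = n\<^sub>2" "dim_row M' = n\<^sub>1" "dim_col M' = n\<^sub>2"
    by (simp_all add: E_def M'_def)
  have "frob_norm E \<le> frob_norm Z * frob_norm W"
    unfolding E_def using frob_norm_mult_le[of Z "transpose_mat W"] by simp
  then have "\<sigma> / 2 * frob_norm E \<le> \<sigma> / 2 * (frob_norm Z * frob_norm W)"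
    using \<sigma>_pos by (intro mult_left_mono) auto
  also have "\<dots> = (q * frob_norm Z) * (q * frob_norm W)"
    unfolding q(2)[symmetric] by (simp only: mult_ac)
  also have "\<dots> \<le> (2 * e) * e"
    by (rule mult_mono[OF ZW(4,5)]) (use e q in auto)
  finally have E: "\<sigma> * frob_norm E \<le> 4 * e\<^sup>2" by (simp add: power2_eq_square)
  have M: "frob_norm M' \<le> \<kappa> * frob_norm E" using M unfolding M'_def E_def .
  have "\<sigma> * ((\<kappa> + 1) * frob_norm E) = (\<kappa> + 1) * (\<sigma> * frob_norm E)" by (simp only: mult_ac)
  also have "\<dots> \<le> (\<kappa> + 1) * (4 * e\<^sup>2)" using \<kappa>(1) by (intro mult_left_mono[OF E]) simp
  also have "\<dots> = (4 * (\<kappa> + 1) * e) * e" by (simp add: power2_eq_square)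
  also have "\<dots> \<le> \<sigma> * e" using \<kappa> e by (intro mult_right_mono) auto
  finally have E_e: "(\<kappa> + 1) * frob_norm E \<le> e" using \<sigma>_pos by simp
  have R_eq: "R = U * transpose_mat V - (U + Z) * transpose_mat (V + W)"
    unfolding R_def ZW(3)[symmetric] ..
  have "L = M' - (R + E)"
    unfolding L_def M'_def R_eq E_def
    by (rule eq_matI) (auto simp: mat_ring_simps simp del: index_mult_mat(1))
  then have "frob_norm L \<le> frob_norm M' + (e + frob_norm E)"
    using frob_norm_triangle_minus[of M' "R + E"] frob_norm_triangle[of R E] by (simp add: e_def)
  then have "frob_norm L \<le> 2 * e" using M E_e by (simp add: algebra_simps)
  then have "(frob_norm L)\<^sup>2 \<le> (2 * e)\<^sup>2" by (intro power_mono) auto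
  then have "\<sigma> / 2 * S \<le> 4 * e\<^sup>2"
    using linearization_ge[OF \<Delta> balanced] unfolding L_def S_def by (simp add: power_mult_distrib)
  then have S: "\<sigma> * S \<le> 8 * e\<^sup>2" by simp
  then show "\<sigma> * ((frob_norm \<Delta>U)\<^sup>2 + (frob_norm \<Delta>V)\<^sup>2) \<le> 8 * e\<^sup>2" by (simp add: S_def)
  have "2 * frob_norm (\<Delta>U * transpose_mat \<Delta>V) \<le> 2 * (frob_norm \<Delta>U * frob_norm \<Delta>V)"
    using frob_norm_mult_le[of \<Delta>U "transpose_mat \<Delta>V"] by simp
  also have "\<dots> \<le> S" unfolding S_def using sum_squares_bound[of "frob_norm \<Delta>U" "frob_norm \<Delta>V"] by simp
  finally have "\<sigma> * (2 * frob_norm (\<Delta>U * transpose_mat \<Delta>V)) \<le> \<sigma> * S"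
    using \<sigma>_pos by (intro mult_left_mono) auto
  also note S
  finally have quad: "\<sigma> * frob_norm (\<Delta>U * transpose_mat \<Delta>V) \<le> 4 * e\<^sup>2" by simp
  have "(U + \<Delta>U) * transpose_mat (V + \<Delta>V) - X = (M' - E) + \<Delta>U * transpose_mat \<Delta>V"
    unfolding M'_def E_def ZW(3)
    by (rule eq_matI) (auto simp: mat_ring_simps simp del: index_mult_mat(1))
  then have "frob_norm ((U + \<Delta>U) * transpose_mat (V + \<Delta>V) - X)
      \<le> frob_norm M' + frob_norm E + frob_norm (\<Delta>U * transpose_mat \<Delta>V)"
    using frob_norm_triangle[of "M' - E" "\<Delta>U * transpose_mat \<Delta>V"] frob_norm_triangle_minus[of M' E]
    by simp
  also have "\<dots> \<le> (\<kappa> + 1) * frob_norm E + frob_norm (\<Delta>U * transpose_mat \<Delta>V)"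
    using M by (simp add: algebra_simps)
  finally have "\<sigma> * frob_norm ((U + \<Delta>U) * transpose_mat (V + \<Delta>V) - X)
      \<le> \<sigma> * ((\<kappa> + 1) * frob_norm E + frob_norm (\<Delta>U * transpose_mat \<Delta>V))"
    using \<sigma>_pos by (intro mult_left_mono) auto
  also have "\<dots> = (\<kappa> + 1) * (\<sigma> * frob_norm E) + \<sigma> * frob_norm (\<Delta>U * transpose_mat \<Delta>V)"
    by (simp add: algebra_simps)
  also have "\<dots> \<le> (\<kappa> + 1) * (4 * e\<^sup>2) + 4 * e\<^sup>2"
    using E \<kappa> quad by (intro add_mono mult_left_mono) auto
  finally show "\<sigma> * frob_norm ((U + \<Delta>U) * transpose_mat (V + \<Delta>V) - X) \<le> 4 * (\<kappa> + 2) * e\<^sup>2"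
    by (simp add: algebra_simps)
qed

lemma step_imbalance:
  assumes [simp]: "dim_row \<Delta>U = n\<^sub>1" "dim_col \<Delta>U = r" "dim_row \<Delta>V = n\<^sub>2" "dim_col \<Delta>V = r"
    and balanced: "transpose_mat U * \<Delta>U = transpose_mat \<Delta>V * V"
  shows "frob_norm (transpose_mat (U + \<Delta>U) * (U + \<Delta>U) - transpose_mat (V + \<Delta>V) * (V + \<Delta>V))
    \<le> frob_norm (transpose_mat U * U - transpose_mat V * V) + ((frob_norm \<Delta>U)\<^sup>2 + (frob_norm \<Delta>V)\<^sup>2)"
proof -
  have balanced': "transpose_mat \<Delta>U * U = transpose_mat V * \<Delta>V"
    using arg_cong[OF balanced, of transpose_mat] by (simp add: mat_transpose_mult)
  have "transpose_mat (U + \<Delta>U) * (U + \<Delta>U) - transpose_mat (V + \<Delta>V) * (V + \<Delta>V)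
      = (transpose_mat U * U - transpose_mat V * V) + (transpose_mat \<Delta>U * \<Delta>U - transpose_mat \<Delta>V * \<Delta>V)"
    by (rule eq_matI) (auto simp: mat_ring_simps balanced balanced' simp del: index_mult_mat(1))
  then have "frob_norm (transpose_mat (U + \<Delta>U) * (U + \<Delta>U) - transpose_mat (V + \<Delta>V) * (V + \<Delta>V))
      \<le> frob_norm (transpose_mat U * U - transpose_mat V * V)
        + (frob_norm (transpose_mat \<Delta>U * \<Delta>U) + frob_norm (transpose_mat \<Delta>V * \<Delta>V))"
    using frob_norm_triangle[of "transpose_mat U * U - transpose_mat V * V" "transpose_mat \<Delta>U * \<Delta>U - transpose_mat \<Delta>V * \<Delta>V"]
      frob_norm_triangle_minus[of "transpose_mat \<Delta>U * \<Delta>U" "transpose_mat \<Delta>V * \<Delta>V"] by simp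
  moreover have "frob_norm (transpose_mat \<Delta>U * \<Delta>U) \<le> (frob_norm \<Delta>U)\<^sup>2"
    using frob_norm_mult_le[of "transpose_mat \<Delta>U" \<Delta>U] by (simp add: power2_eq_square)
  moreover have "frob_norm (transpose_mat \<Delta>V * \<Delta>V) \<le> (frob_norm \<Delta>V)\<^sup>2"
    using frob_norm_mult_le[of "transpose_mat \<Delta>V" \<Delta>V] by (simp add: power2_eq_square)
  ultimately show ?thesis by linarith
qed

end

lemma gnmr_step:
  fixes U V X :: "real mat" and r :: nat
  defines "err \<equiv> \<lambda>U V. frob_norm (U * transpose_mat V - X)"
    and "imb \<equiv> \<lambda>U V. frob_norm (transpose_mat U * U - transpose_mat V * V)"
    and "\<sigma> \<equiv> singular_value r X"
  assumes lin: "linear_map class_ring (module_mat TYPE(real) n\<^sub>1 n\<^sub>2) (module_vec TYPE(real) m) \<A>"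
    and rip: "RIP n\<^sub>1 n\<^sub>2 (2 * r) \<delta>' \<A>" and \<delta>: "\<delta>' \<le> \<delta>" "\<delta> < 1"
    and X: "X \<in> carrier_mat n\<^sub>1 n\<^sub>2" "mat_rank X = r" "1 \<le> r"
    and c: "8 * (rip_ratio \<delta> + 2) \<le> c"
    and U: "U \<in> carrier_mat n\<^sub>1 r" and V: "V \<in> carrier_mat n\<^sub>2 r"
    and err: "err U V \<le> \<sigma> / c" and imb: "imb U V \<le> \<sigma> / c - err U V / 2"
    and upd: "gnmr_update n\<^sub>1 n\<^sub>2 r \<A> (\<A> X) U V (\<Delta>U, \<Delta>V)"
  shows "U + \<Delta>U \<in> carrier_mat n\<^sub>1 r" "V + \<Delta>V \<in> carrier_mat n\<^sub>2 r"
    and "err (U + \<Delta>U) (V + \<Delta>V) \<le> c / (2 * \<sigma>) * (err U V)\<^sup>2"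
    and "err (U + \<Delta>U) (V + \<Delta>V) \<le> \<sigma> / c"
    and "imb (U + \<Delta>U) (V + \<Delta>V) \<le> \<sigma> / c - err (U + \<Delta>U) (V + \<Delta>V) / 2"
proof -
  have min: "gnmr_minimizer n\<^sub>1 n\<^sub>2 r \<A> (\<A> X) U V (\<Delta>U, \<Delta>V)"
    using upd by (simp add: gnmr_update_def is_arg_min_def)
  then have \<Delta>: "\<Delta>U \<in> carrier_mat n\<^sub>1 r" "\<Delta>V \<in> carrier_mat n\<^sub>2 r"
    by (auto simp: gnmr_minimizer_def is_arg_min_def)
  show "U + \<Delta>U \<in> carrier_mat n\<^sub>1 r" "V + \<Delta>V \<in> carrier_mat n\<^sub>2 r"
    using U V \<Delta> by auto
  obtain A B where AB: "A \<in> carrier_mat n\<^sub>1 r" "B \<in> carrier_mat n\<^sub>2 r" "X = A * transpose_mat B"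
    "transpose_mat B * B = 1\<^sub>m r" "0 < \<sigma>" "\<And>Y. dim_row Y = r \<Longrightarrow> \<sigma> * frob_norm Y \<le> frob_norm (A * Y)"
    using compact_singular_value_decomposition[OF X] unfolding \<sigma>_def by blast
  define \<kappa> where "\<kappa> = rip_ratio \<delta>"
  have "0 \<le> \<delta>'" using rip by (simp add: RIP_def)
  then have \<kappa>: "2 \<le> \<kappa>" unfolding \<kappa>_def using \<delta> by (intro rip_ratio_ge_2) auto
  have c\<kappa>: "8 * (\<kappa> + 2) \<le> c" using c by (simp add: \<kappa>_def)
  have c32: "32 \<le> c" using c\<kappa> \<kappa> by simp
  have "\<sigma> / c \<le> \<sigma> / 32" using AB(5) c32 by (intro divide_left_mono) auto
  moreover have e0: "0 \<le> err U V" by (simp add: err_def)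
  ultimately have b: "err U V \<le> \<sigma> / 32" "imb U V \<le> \<sigma> / 32"
    using err imb by linarith+
  interpret nf: near_factorization n\<^sub>1 n\<^sub>2 r A B U V X \<sigma>
    by (rule near_factorization.intro[OF AB(1,2) U V AB(3-6) b[unfolded err_def imb_def]])
  define e where "e = err U V"
  have e_eq: "nf.e = e" by (simp add: nf.e_def nf.R_def err_def e_def)
  have e0: "0 \<le> e" using e0 by (simp add: e_def)
  define e' where "e' = err (U + \<Delta>U) (V + \<Delta>V)"
  have ec: "c * e \<le> \<sigma>" using err c32 by (simp add: e_def field_simps)
  have "4 * (\<kappa> + 1) * e \<le> c * e" using c\<kappa> \<kappa> e0 by (intro mult_right_mono) auto
  then have \<kappa>e: "4 * (\<kappa> + 1) * e \<le> \<sigma>" using ec by simp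
  obtain Z W where ZW: "Z \<in> carrier_mat n\<^sub>1 r" "W \<in> carrier_mat n\<^sub>2 r" "X = (U + Z) * transpose_mat (V + W)"
    "nf.q * frob_norm Z \<le> 2 * nf.e" "nf.q * frob_norm W \<le> nf.e"
    using nf.nearby_exact_factors by blast
  note bal = gnmr_update_balanced[OF U V upd]
  note M = gnmr_minimizer_error_bound[OF lin rip \<delta> U V ZW(1-3) min, folded \<kappa>_def]
  note dims\<Delta> = carrier_matD[OF \<Delta>(1)] carrier_matD[OF \<Delta>(2)]
  note bounds = nf.step_bounds[OF dims\<Delta> bal ZW _ _ M, unfolded e_eq, OF _ \<kappa>e]
  have S: "\<sigma> * ((frob_norm \<Delta>U)\<^sup>2 + (frob_norm \<Delta>V)\<^sup>2) \<le> 8 * e\<^sup>2"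
    using bounds(1) \<kappa> by simp
  have "\<sigma> * e' \<le> 4 * (\<kappa> + 2) * e\<^sup>2"
    unfolding e'_def err_def using bounds(2) \<kappa> by simp
  also have "\<dots> \<le> c / 2 * e\<^sup>2" using c\<kappa> by (intro mult_right_mono) auto
  finally have quad: "\<sigma> * e' \<le> c / 2 * e\<^sup>2" .
  then have "e' \<le> c / (2 * \<sigma>) * e\<^sup>2" using AB(5) by (simp add: field_simps)
  then show "err (U + \<Delta>U) (V + \<Delta>V) \<le> c / (2 * \<sigma>) * (err U V)\<^sup>2"
    by (simp add: e'_def e_def)
  have c_e2: "c * e\<^sup>2 \<le> \<sigma> * e"
    using mult_right_mono[OF ec e0] by (simp add: power2_eq_square mult.assoc)
  have "\<sigma> * e' \<le> \<sigma> * (e / 2)" using quad c_e2 by simp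
  then have e': "e' \<le> e / 2" using AB(5) by (simp only: mult_le_cancel_left_pos)
  then show "err (U + \<Delta>U) (V + \<Delta>V) \<le> \<sigma> / c"
    using err e0 by (simp add: e'_def e_def)
  have "32 * e\<^sup>2 \<le> c * e\<^sup>2" using c32 by (intro mult_right_mono) auto
  then have "\<sigma> * ((frob_norm \<Delta>U)\<^sup>2 + (frob_norm \<Delta>V)\<^sup>2) \<le> \<sigma> * (e / 4)" using S c_e2 by simp
  then have "(frob_norm \<Delta>U)\<^sup>2 + (frob_norm \<Delta>V)\<^sup>2 \<le> e / 4"
    using AB(5) by (simp only: mult_le_cancel_left_pos)
  then have "imb (U + \<Delta>U) (V + \<Delta>V) \<le> imb U V + e / 4"
    using nf.step_imbalance[OF dims\<Delta> bal] by (simp add: imb_def)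
  then show "imb (U + \<Delta>U) (V + \<Delta>V) \<le> \<sigma> / c - err (U + \<Delta>U) (V + \<Delta>V) / 2"
    using imb e' by (simp add: e'_def e_def)
qed

theorem theorem3p3:
  fixes \<delta> :: real
  assumes "0 < \<delta>" and "\<delta> < 1"
  shows "\<exists>c\<^sub>0>0. \<forall>c\<^sub>e\<ge>c\<^sub>0.
    \<forall>(n\<^sub>1 :: nat) (n\<^sub>2 :: nat) (m :: nat) (r :: nat) (\<A> :: real mat \<Rightarrow> real vec) (\<delta>\<^sub>2\<^sub>r :: real)
      (X' :: real mat) (U\<^sub>0 :: real mat) (V\<^sub>0 :: real mat)
      (U :: nat \<Rightarrow> real mat) (V :: nat \<Rightarrow> real mat).
      let \<sigma> = singular_value r X'; \<gamma> = c\<^sub>e / (2 * \<sigma>) in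
      1 \<le> r \<longrightarrow>
      linear_map class_ring (module_mat TYPE(real) n\<^sub>1 n\<^sub>2) (module_vec TYPE(real) m) \<A> \<longrightarrow>
      RIP n\<^sub>1 n\<^sub>2 (2 * r) \<delta>\<^sub>2\<^sub>r \<A> \<longrightarrow> \<delta>\<^sub>2\<^sub>r \<le> \<delta> \<longrightarrow>
      X' \<in> carrier_mat n\<^sub>1 n\<^sub>2 \<longrightarrow> mat_rank X' = r \<longrightarrow>
      U\<^sub>0 \<in> carrier_mat n\<^sub>1 r \<longrightarrow> V\<^sub>0 \<in> carrier_mat n\<^sub>2 r \<longrightarrow>
      frob_norm (U\<^sub>0 * transpose_mat V\<^sub>0 - X') \<le> \<sigma> / c\<^sub>e \<longrightarrow>
      frob_norm (transpose_mat U\<^sub>0 * U\<^sub>0 - transpose_mat V\<^sub>0 * V\<^sub>0) \<le> \<sigma> / (2 * c\<^sub>e) \<longrightarrow>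
      gnmr_iterates n\<^sub>1 n\<^sub>2 r \<A> (\<A> X') U\<^sub>0 V\<^sub>0 U V \<longrightarrow>
      (\<forall>t. frob_norm (U (Suc t) * transpose_mat (V (Suc t)) - X')
             \<le> \<gamma> * (frob_norm (U t * transpose_mat (V t) - X'))\<^sup>2)"
proof -
  define c\<^sub>0 where "c\<^sub>0 = 8 * (rip_ratio \<delta> + 2)"
  have c0: "0 < c\<^sub>0" using rip_ratio_ge_2[of \<delta>] assms by (simp add: c\<^sub>0_def)
  show ?thesis
    unfolding Let_def
  proof (intro exI[of _ c\<^sub>0] conjI allI impI)
    show "0 < c\<^sub>0" by (rule c0)
    fix c\<^sub>e \<delta>' :: real and n\<^sub>1 n\<^sub>2 m r :: nat and \<A> X U\<^sub>0 V\<^sub>0 and U V :: "nat \<Rightarrow> real mat" and t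
    assume c: "c\<^sub>0 \<le> c\<^sub>e" and r: "1 \<le> r"
      and lin: "linear_map class_ring (module_mat TYPE(real) n\<^sub>1 n\<^sub>2) (module_vec TYPE(real) m) \<A>"
      and rip: "RIP n\<^sub>1 n\<^sub>2 (2 * r) \<delta>' \<A>" and \<delta>': "\<delta>' \<le> \<delta>"
      and X: "X \<in> carrier_mat n\<^sub>1 n\<^sub>2" "mat_rank X = r"
      and UV0: "U\<^sub>0 \<in> carrier_mat n\<^sub>1 r" "V\<^sub>0 \<in> carrier_mat n\<^sub>2 r"
      and err: "frob_norm (U\<^sub>0 * transpose_mat V\<^sub>0 - X) \<le> singular_value r X / c\<^sub>e"
      and imb: "frob_norm (transpose_mat U\<^sub>0 * U\<^sub>0 - transpose_mat V\<^sub>0 * V\<^sub>0) \<le> singular_value r X / (2 * c\<^sub>e)"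
      and it: "gnmr_iterates n\<^sub>1 n\<^sub>2 r \<A> (\<A> X) U\<^sub>0 V\<^sub>0 U V"
    define \<sigma> where "\<sigma> = singular_value r X"
    define e where "e t = frob_norm (U t * transpose_mat (V t) - X)" for t
    define I where "I t \<longleftrightarrow> U t \<in> carrier_mat n\<^sub>1 r \<and> V t \<in> carrier_mat n\<^sub>2 r \<and> e t \<le> \<sigma> / c\<^sub>e \<and>
      frob_norm (transpose_mat (U t) * U t - transpose_mat (V t) * V t) \<le> \<sigma> / c\<^sub>e - e t / 2" for t
    have step: "I (Suc t) \<and> e (Suc t) \<le> c\<^sub>e / (2 * \<sigma>) * (e t)\<^sup>2" if "I t" for t
    proof -
      obtain \<Delta>U \<Delta>V where upd: "gnmr_update n\<^sub>1 n\<^sub>2 r \<A> (\<A> X) (U t) (V t) (\<Delta>U, \<Delta>V)"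
        and Suc: "U (Suc t) = U t + \<Delta>U" "V (Suc t) = V t + \<Delta>V"
        using it unfolding gnmr_iterates_def by blast
      show ?thesis
        using gnmr_step[OF lin rip \<delta>' assms(2) X r c[unfolded c\<^sub>0_def], of "U t" "V t" \<Delta>U \<Delta>V] that upd
        unfolding I_def e_def Suc \<sigma>_def by blast
    qed
    have "I 0"
      using it UV0 err imb unfolding gnmr_iterates_def I_def e_def \<sigma>_def by (auto simp: field_simps)
    then have "I t" by (induction t) (use step in blast)+
    then show "frob_norm (U (Suc t) * transpose_mat (V (Suc t)) - X)
        \<le> c\<^sub>e / (2 * singular_value r X) * (frob_norm (U t * transpose_mat (V t) - X))\<^sup>2"
      using step unfolding e_def \<sigma>_def by blast
  qed
qed

end
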